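(* Let $n\ge1$. If $\mathscr P$ is a pointed $\mathbb{Z}$-retract of $[0,1]^n$, then (1) $\mathscr P$ is contractible, and (2) $\mathscr P$ is strongly regular. If $\mathscr P$ is one-dimensional, the converse also holds: every one-dimensional pointed rational polyhedron $\mathscr P\subseteq[0,1]^n$ that is contractible and strongly regular is a pointed $\mathbb{Z}$-retract of $[0,1]^n$.
   Context: A rational polyhedron is a finite union of convex hulls of finitely many points with rational coordinates. A polyhedron in $[0,1]^n$ is pointed if it contains $\mathbf 1=(1,\dots,1)$. A polyhedron is contractible if it is homotopically equivalent to a point. For a rational vector $x$, $\mathrm{den}(x)$ is the least common denominator of its coordinates. A rational polyhedron $\mathscr P$ is strongly regular if for each rational vector $v\in\mathscr P$ and each real $\delta>0$ there is a rational vector $w\in\mathscr P$ with Euclidean distance $\mathrm{dist}(v,w)<\delta$ and $\gcd(\mathrm{den}(v),\mathrm{den}(w))=1$. A $\mathbb{Z}$-map $[0,1]^n\to[0,1]^n$ is a continuous map each of whose components is piecewise (affine) linear with integer coefficients; it is pointed if it maps $\mathbf 1$ to $\mathbf 1$. A pointed $\mathbb{Z}$-retraction is a pointed $\mathbb{Z}$-map $\zeta:[0,1]^n\to[0,1]^n$ with $\zeta\circ\zeta=\zeta$; its image $\zeta([0,1]^n)$ is called a pointed $\mathbb{Z}$-retract of $[0,1]^n$. *)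

theory Defs
  imports "HOL-Analysis.Analysis"
begin

abbreviation unit_cube :: "(real ^ 'n) set"
  where "unit_cube \<equiv> cbox 0 1"

definition rational_vec :: "real ^ 'n \<Rightarrow> bool"
  where "rational_vec x \<longleftrightarrow> (\<forall>i. x $ i \<in> \<rat>)"

text \<open>Only meaningful for rational vectors, where the set of common denominators is nonempty.\<close>
definition den :: "real ^ 'n \<Rightarrow> nat"
  where "den x = (LEAST d. d > 0 \<and> (\<forall>i. real d * x $ i \<in> \<int>))"

definition rational_polyhedron :: "(real ^ 'n) set \<Rightarrow> bool"
  where "rational_polyhedron P \<longleftrightarrow>
    (\<exists>\<V>. finite \<V> \<and> (\<forall>V\<in>\<V>. finite V \<and> (\<forall>v\<in>V. rational_vec v)) \<and>
         P = (\<Union>V\<in>\<V>. convex hull V))"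

text \<open>The dimension of a polyhedron is the largest dimension of a simplex contained in it, so that
  a union of differently directed segments has dimension 1, whereas its \<^const>\<open>aff_dim\<close> may be
  larger.  The maximum exists: the empty set is a simplex of dimension -1.\<close>
definition polyhedron_dim :: "(real ^ 'n) set \<Rightarrow> int"
  where "polyhedron_dim P = Max {k. \<exists>S. k simplex S \<and> S \<subseteq> P}"

definition pointed :: "(real ^ 'n) set \<Rightarrow> bool"
  where "pointed P \<longleftrightarrow> P \<subseteq> unit_cube \<and> 1 \<in> P"

definition strongly_regular :: "(real ^ 'n) set \<Rightarrow> bool"
  where "strongly_regular P \<longleftrightarrow> rational_polyhedron P \<and>
    (\<forall>v\<in>P. rational_vec v \<longrightarrow>
      (\<forall>\<delta>>0. \<exists>w\<in>P. rational_vec w \<and> dist v w < \<delta> \<and> gcd (den v) (den w) = 1))"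

text \<open>For a continuous function, being piecewise affine linear with integer coefficients means that
  its values are everywhere among those of finitely many affine functions with integer coefficients
  (McNaughton functions).  Continuity is imposed in \<open>Z_map\<close>.\<close>
definition piecewise_int_linear_on :: "(real ^ 'n) set \<Rightarrow> (real ^ 'n \<Rightarrow> real) \<Rightarrow> bool"
  where "piecewise_int_linear_on S f \<longleftrightarrow>
    (\<exists>L :: ((int ^ 'n) \<times> int) set. finite L \<and>
      (\<forall>x\<in>S. \<exists>(a, b)\<in>L. f x = (\<Sum>i\<in>UNIV. of_int (a $ i) * x $ i) + of_int b))"

text \<open>Maps of the cube are represented by total functions, of which only the restriction to the
  cube matters.\<close>
definition Z_map :: "(real ^ 'n \<Rightarrow> real ^ 'n) \<Rightarrow> bool"
  where "Z_map f \<longleftrightarrow> continuous_on unit_cube f \<and> f \<in> unit_cube \<rightarrow> unit_cube \<and>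
    (\<forall>j. piecewise_int_linear_on unit_cube (\<lambda>x. f x $ j))"

definition pointed_Z_retraction :: "(real ^ 'n \<Rightarrow> real ^ 'n) \<Rightarrow> bool"
  where "pointed_Z_retraction \<zeta> \<longleftrightarrow> Z_map \<zeta> \<and> \<zeta> 1 = 1 \<and> (\<forall>x\<in>unit_cube. \<zeta> (\<zeta> x) = \<zeta> x)"

definition pointed_Z_retract :: "(real ^ 'n) set \<Rightarrow> bool"
  where "pointed_Z_retract P \<longleftrightarrow> (\<exists>\<zeta>. pointed_Z_retraction \<zeta> \<and> P = \<zeta> ` unit_cube)"

end

theory Submission
  imports Defs
begin

text \<open>Given a tree of segments rooted at \<open>1\<close> whose lines carry integer points, each segment
  has an integral coordinate, and these can be rescaled to integral heights such that descending
  towards the root by a given amount of height is integer affine in the coordinate, across vertices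
  too: at a vertex the coordinates on two segments have the same denominator, so that the speed
  on the lower segment can be chosen in the right residue class.  A point of the cube is sent to the
  point whose height is the coordinate height on the best segment \<open>e\<close> minus a large integer multiple
  of an integral distance to \<open>e\<close>; for distinct segments the candidate heights then only compete
  below their common point.

  Strong regularity at a generic point of a segment says exactly that its line contains an integer
  point, and contractibility excludes cycles because a closed edge path would wrap nontrivially
  around a circle.  Conversely, a retract is the fixed point set of the retraction, and a
  retraction does not increase denominators, while rational points with denominators prime to
  a given one are dense in the cube.\<close>

section \<open>Integer vectors and piecewise integer linear functions\<close>

text \<open>Only integer coefficients are available, so a coordinate cannot be clamped at the end of
  a segment: the ends are merely rational, and a constant piece with a non-integral value is not
  allowed. This is why candidates are pushed downwards. Below the lower end the motion continues
  along other segments to the root, where stopping is legitimate because \<open>1\<close> has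
  integer coordinates; at the upper end the integral distance already contains a multiple of the
  overshoot and pulls the coordinate back. The integer point on each line serves the same purpose:
  the coordinate on the line z + \<theta> c is \<phi> . (x - z) for an integral functional \<phi>
  with \<phi> . c = 1, and its constant term is integral once z is. For the necessity of the
  conditions, the delicate point is that a retract is a rational polyhedron at all, because a
  piecewise linear map is given by finitely many pieces without regions; the regions are recovered
  as cells of the hyperplanes on which two pieces, or a piece and a coordinate, agree.\<close>

definition int_vec :: "real ^ 'n \<Rightarrow> bool"
  where "int_vec x \<longleftrightarrow> (\<forall>i. x $ i \<in> \<int>)"

lemma int_vec_inner: "int_vec a \<Longrightarrow> int_vec b \<Longrightarrow> a \<bullet> b \<in> \<int>"
  by (auto simp: int_vec_def inner_vec_def intro!: Ints_sum Ints_mult)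

lemma int_vec_diff: "int_vec a \<Longrightarrow> int_vec b \<Longrightarrow> int_vec (a - b)"
  by (auto simp: int_vec_def)

lemma int_vec_add: "int_vec a \<Longrightarrow> int_vec b \<Longrightarrow> int_vec (a + b)"
  by (auto simp: int_vec_def)

lemma int_vec_scaleR: "r \<in> \<int> \<Longrightarrow> int_vec a \<Longrightarrow> int_vec (r *\<^sub>R a)"
  by (auto simp: int_vec_def)

lemma int_vec_axis: "int_vec (axis i 1 :: real ^ 'n)"
  by (auto simp: int_vec_def axis_def)

lemma int_vec_imp_rational_vec: "int_vec x \<Longrightarrow> rational_vec x"
  unfolding int_vec_def rational_vec_def using Ints_subset_Rats by blast

lemma rational_vec_inner: "rational_vec a \<Longrightarrow> rational_vec b \<Longrightarrow> a \<bullet> b \<in> \<rat>"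
  by (auto simp: rational_vec_def inner_vec_def intro!: Rats_sum Rats_mult)

lemma rational_vec_diff: "rational_vec a \<Longrightarrow> rational_vec b \<Longrightarrow> rational_vec (a - b)"
  by (auto simp: rational_vec_def)

lemma rational_vec_add: "rational_vec a \<Longrightarrow> rational_vec b \<Longrightarrow> rational_vec (a + b)"
  by (auto simp: rational_vec_def)

lemma rational_vec_scaleR: "r \<in> \<rat> \<Longrightarrow> rational_vec a \<Longrightarrow> rational_vec (r *\<^sub>R a)"
  by (auto simp: rational_vec_def)

lemma Rats_common_denominator:
  fixes A :: "real set"
  assumes "finite A" "A \<subseteq> \<rat>"
  obtains m :: nat where "m > 0" "\<And>x. x \<in> A \<Longrightarrow> real m * x \<in> \<int>"
proof -
  have "\<exists>m::nat. m > 0 \<and> (\<forall>x\<in>A. real m * x \<in> \<int>)"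
    using assms
  proof (induction rule: finite_induct)
    case (insert x A)
    then obtain m :: nat where m: "m > 0" "\<forall>y\<in>A. real m * y \<in> \<int>"
      by auto
    have "x \<in> \<rat>" using insert.prems by simp
    then obtain k :: int and l :: nat where x: "x = of_int k / of_nat l" "l \<noteq> 0"
      unfolding Rats_eq_int_div_nat by blast
    have "real (l * m) * y \<in> \<int>" if "y \<in> insert x A" for y
    proof (cases "y = x")
      case True
      have "real (l * m) * x = of_int (int m * k)" using x by simp
      then show ?thesis using True Ints_of_int by metis
    next
      case False
      then have "real m * y \<in> \<int>" using m that by auto
      then have "real l * (real m * y) \<in> \<int>" using Ints_mult Ints_of_nat by blast
      then show ?thesis by (metis mult.assoc of_nat_mult)
    qed
    then show ?case using m x by (intro exI[of _ "l * m"]) auto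
  qed auto
  then show ?thesis using that by blast
qed

text \<open>Bezout: the least positive value of the integer functionals at a nonzero integer vector is
  the gcd of its entries.\<close>
lemma primitive_multiple:
  fixes u :: "real ^ 'n"
  assumes "int_vec u" "u \<noteq> 0"
  obtains g :: nat and c \<phi> :: "real ^ 'n"
  where "g > 0" "int_vec c" "int_vec \<phi>" "\<phi> \<bullet> c = 1" "u = real g *\<^sub>R c"
proof -
  define A where "A = {g :: nat. g > 0 \<and> (\<exists>\<phi>. int_vec \<phi> \<and> \<phi> \<bullet> u = real g)}"
  have "u \<bullet> u \<in> \<int>" "u \<bullet> u > 0" using assms by (auto intro: int_vec_inner)
  then obtain k :: int where k: "u \<bullet> u = of_int k" unfolding Ints_def by blast
  with \<open>u \<bullet> u > 0\<close> have "k > 0" by simp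
  then have "nat k \<in> A" using assms k unfolding A_def
    by (auto intro!: exI[of _ u])
  define g where "g = (LEAST g. g \<in> A)"
  have g: "g \<in> A" "\<And>h. h \<in> A \<Longrightarrow> g \<le> h"
    using \<open>nat k \<in> A\<close> unfolding g_def by (auto intro: LeastI Least_le)
  then obtain \<phi> where phi: "int_vec \<phi>" "\<phi> \<bullet> u = real g" and g0: "g > 0"
    unfolding A_def by auto
  have dvd: "u $ i / real g \<in> \<int>" for i
  proof -
    obtain k where k: "u $ i = of_int k" using assms unfolding int_vec_def Ints_def by blast
    define r where "r = k mod int g"
    have r: "0 \<le> r" "r < int g" using g0 by (auto simp: r_def)
    have "r = 0"
    proof (rule ccontr)
      assume "r \<noteq> 0"
      \<comment> \<open>Division with remainder: subtracting a multiple of \<phi> from the i-th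
        coordinate functional leaves an integral functional with value \<open>r\<close> at
        \<open>u\<close>, which would be positive and below the minimal \<open>g\<close>.\<close>
      let ?\<psi> = "axis i 1 - of_int (k div int g) *\<^sub>R \<phi>"
      have "?\<psi> \<bullet> u = of_int k - of_int (k div int g) * real g"
        using phi k by (simp add: inner_diff_left inner_axis')
      also have "\<dots> = of_int (k - (k div int g) * int g)"
        by simp
      also have "\<dots> = of_int r"
        unfolding r_def by (simp only: minus_div_mult_eq_mod)
      finally have "?\<psi> \<bullet> u = real (nat r)" using r by simp
      moreover have "int_vec ?\<psi>"
        using phi by (intro int_vec_diff int_vec_scaleR int_vec_axis) auto
      ultimately have "nat r \<in> A" using r \<open>r \<noteq> 0\<close> unfolding A_def by auto
      then show False using g(2)[of "nat r"] r by auto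
    qed
    then have "k = int g * (k div int g)" unfolding r_def by auto
    then have "of_int k = real g * of_int (k div int g)"
      by (metis of_int_mult of_int_of_nat_eq)
    then have "u $ i / real g = of_int (k div int g)" using k g0 by simp
    then show ?thesis by simp
  qed
  show ?thesis
  proof (rule that[of g "(1 / real g) *\<^sub>R u" \<phi>])
    show "int_vec ((1 / real g) *\<^sub>R u)" using dvd by (simp add: int_vec_def)
  qed (use g0 phi in auto)
qed

section \<open>Closure properties of piecewise integer linear functions\<close>

lemma pil_affine:
  fixes a :: "real ^ 'n"
  assumes "int_vec a" "b \<in> \<int>"
  shows "piecewise_int_linear_on S (\<lambda>x. a \<bullet> x + b)"
proof -
  obtain b' where b: "b = of_int b'" using assms(2) unfolding Ints_def by blast
  have "real_of_int \<lfloor>a $ i\<rfloor> = a $ i" for i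
    using assms(1) unfolding int_vec_def by (metis floor_of_int Ints_cases)
  then show ?thesis
    unfolding piecewise_int_linear_on_def
    by (intro exI[of _ "{(\<chi> i. \<lfloor>a $ i\<rfloor>, b')}"]) (simp add: b inner_vec_def del: of_int_floor_cancel)
qed

lemma pil_const: "b \<in> \<int> \<Longrightarrow> piecewise_int_linear_on S (\<lambda>x. b)"
  using pil_affine[of 0 b S] by (simp add: int_vec_def)

lemma pil_lincomb:
  assumes "piecewise_int_linear_on S f" "piecewise_int_linear_on S g" "a \<in> \<int>" "b \<in> \<int>"
  shows "piecewise_int_linear_on S (\<lambda>x. a * f x + b * g x)"
proof -
  obtain a' b' where ab: "a = of_int a'" "b = of_int b'" using assms(3,4) unfolding Ints_def by blast
  obtain L where L: "finite L" "\<forall>x\<in>S. \<exists>(a, b)\<in>L. f x = (\<Sum>i\<in>UNIV. of_int (a $ i) * x $ i) + of_int b"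
    using assms(1) unfolding piecewise_int_linear_on_def by blast
  obtain M where M: "finite M" "\<forall>x\<in>S. \<exists>(a, b)\<in>M. g x = (\<Sum>i\<in>UNIV. of_int (a $ i) * x $ i) + of_int b"
    using assms(2) unfolding piecewise_int_linear_on_def by blast
  let ?h = "\<lambda>((c, d), (c', d')). ((\<chi> i. a' * c $ i + b' * c' $ i), a' * d + b' * d')"
  show ?thesis unfolding piecewise_int_linear_on_def
  proof (intro exI[of _ "?h ` (L \<times> M)"] conjI ballI)
    fix x assume "x \<in> S"
    obtain c d where cd: "(c, d) \<in> L" "f x = (\<Sum>i\<in>UNIV. of_int (c $ i) * x $ i) + of_int d"
      using L \<open>x \<in> S\<close> by fast
    obtain c' d' where cd': "(c', d') \<in> M" "g x = (\<Sum>i\<in>UNIV. of_int (c' $ i) * x $ i) + of_int d'"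
      using M \<open>x \<in> S\<close> by fast
    show "\<exists>(c, d)\<in>?h ` (L \<times> M). a * f x + b * g x = (\<Sum>i\<in>UNIV. of_int (c $ i) * x $ i) + of_int d"
    proof (rule bexI[of _ "?h ((c, d), (c', d'))"])
      show "?h ((c, d), (c', d')) \<in> ?h ` (L \<times> M)" using cd cd' by (intro imageI) auto
    qed (simp add: cd cd' ab algebra_simps sum.distrib sum_distrib_left)
  qed (use L M in auto)
qed

text \<open>Piecewise linearity asks for a finite set of affine functions, not for regions, so the
  pieces of all \<open>f i\<close> are pooled, however irregular the sets on which \<open>g\<close>
  follows each of them.\<close>

lemma pil_select:
  assumes "finite I" "\<And>i. i \<in> I \<Longrightarrow> piecewise_int_linear_on S (f i)"
    and "\<And>x. x \<in> S \<Longrightarrow> \<exists>i\<in>I. g x = f i x"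
  shows "piecewise_int_linear_on S g"
proof -
  have "\<forall>i\<in>I. \<exists>L. finite L \<and> (\<forall>x\<in>S. \<exists>(a, b)\<in>L. f i x = (\<Sum>j\<in>UNIV. of_int (a $ j) * x $ j) + of_int b)"
    using assms(2) unfolding piecewise_int_linear_on_def by blast
  then obtain L where L: "\<forall>i\<in>I. finite (L i) \<and> (\<forall>x\<in>S. \<exists>(a, b)\<in>L i. f i x = (\<Sum>j\<in>UNIV. of_int (a $ j) * x $ j) + of_int b)"
    by (rule bchoice[elim_format]) blast
  show ?thesis
    unfolding piecewise_int_linear_on_def
  proof (intro exI[of _ "\<Union>i\<in>I. L i"] conjI ballI)
    fix x assume "x \<in> S"
    then obtain i where i: "i \<in> I" "g x = f i x" using assms(3) by blast
    then obtain a b where "(a, b) \<in> L i" "f i x = (\<Sum>j\<in>UNIV. of_int (a $ j) * x $ j) + of_int b"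
      using L \<open>x \<in> S\<close> by fast
    then show "\<exists>(a, b)\<in>\<Union>i\<in>I. L i. g x = (\<Sum>j\<in>UNIV. of_int (a $ j) * x $ j) + of_int b"
      using i by auto
  qed (use assms L in auto)
qed

lemma pil_add:
  "piecewise_int_linear_on S f \<Longrightarrow> piecewise_int_linear_on S g \<Longrightarrow> piecewise_int_linear_on S (\<lambda>x. f x + g x)"
  using pil_lincomb[of S f g 1 1] by simp

lemma pil_scale:
  "piecewise_int_linear_on S f \<Longrightarrow> a \<in> \<int> \<Longrightarrow> piecewise_int_linear_on S (\<lambda>x. a * f x)"
  using pil_lincomb[of S f f a 0] by simp

lemma pil_max:
  "piecewise_int_linear_on S f \<Longrightarrow> piecewise_int_linear_on S g \<Longrightarrow> piecewise_int_linear_on S (\<lambda>x. max (f x) (g x))"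
  by (rule pil_select[where I = "UNIV :: bool set" and f = "\<lambda>i. if i then f else g"]) (auto simp: max_def)

lemma pil_abs:
  assumes "piecewise_int_linear_on S f"
  shows "piecewise_int_linear_on S (\<lambda>x. \<bar>f x\<bar>)"
proof -
  have "\<bar>y\<bar> = max y (- 1 * y)" for y :: real by auto
  then show ?thesis
    using pil_max[OF assms pil_scale[OF assms, of "-1"]] by simp
qed

lemma pil_sum:
  "finite I \<Longrightarrow> (\<And>i. i \<in> I \<Longrightarrow> piecewise_int_linear_on S (f i)) \<Longrightarrow> piecewise_int_linear_on S (\<lambda>x. \<Sum>i\<in>I. f i x)"
  by (induction I rule: finite_induct) (auto intro: pil_const pil_add)

section \<open>Rooted trees of integral segments\<close>

text \<open>The end with coordinate \<open>low\<close> is the one towards the root \<open>1\<close>.  For \<open>\<theta> \<le> high\<close>, \<open>descent\<close> runs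
  through the whole path from the root to the other end, parametrized by the coordinate of the
  segment extended affinely in height; \<open>\<theta> \<mapsto> slope * \<theta> + shift\<close> is the height.\<close>
record 'n edge =
  origin :: "real ^ 'n"
  direction :: "real ^ 'n"
  functional :: "real ^ 'n"
  low :: real
  high :: real
  slope :: real
  shift :: real
  descent :: "real \<Rightarrow> real ^ 'n"

definition seg :: "('n::finite) edge \<Rightarrow> (real ^ 'n) set"
  where "seg e = (\<lambda>\<theta>. origin e + \<theta> *\<^sub>R direction e) ` {low e..high e}"

definition coord :: "('n::finite) edge \<Rightarrow> real ^ 'n \<Rightarrow> real"
  where "coord e x = functional e \<bullet> (x - origin e)"

definition height :: "('n::finite) edge \<Rightarrow> real \<Rightarrow> real"
  where "height e \<theta> = slope e * \<theta> + shift e"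

definition point_at :: "('n::finite) edge \<Rightarrow> real \<Rightarrow> real ^ 'n"
  where "point_at e h = descent e ((h - shift e) / slope e)"

text \<open>\<open>P\<close> enters only as the set in which the descent takes its values. The
  nonnegative height at \<open>low\<close> keeps the segment at or above height 0, and from height 0
  downwards the descent rests at the root. The last clause is piecewise integer linearity in one
  variable, with one set of pieces for all components. \<open>low e = high e\<close> is allowed and
  represents the tree that is only a root.\<close>

definition is_edge :: "(real ^ 'n::finite) set \<Rightarrow> 'n edge \<Rightarrow> bool"
  where "is_edge P e \<longleftrightarrow>
    int_vec (origin e) \<and> int_vec (direction e) \<and> int_vec (functional e) \<and>
    functional e \<bullet> direction e = 1 \<and>
    low e \<in> \<rat> \<and> high e \<in> \<rat> \<and> low e \<le> high e \<and>
    slope e \<in> \<int> \<and> 0 < slope e \<and> shift e \<in> \<int> \<and> 0 \<le> height e (low e) \<and>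
    continuous_on {..high e} (descent e) \<and> descent e ` {..high e} \<subseteq> P \<and>
    (\<forall>\<theta>\<in>{low e..high e}. descent e \<theta> = origin e + \<theta> *\<^sub>R direction e) \<and>
    (\<forall>\<theta>\<le>high e. height e \<theta> \<le> 0 \<longrightarrow> descent e \<theta> = 1) \<and>
    (\<exists>K. finite K \<and> K \<subseteq> \<int> \<times> \<int> \<and> (\<forall>\<theta>\<le>high e. \<forall>j. \<exists>(a, b)\<in>K. descent e \<theta> $ j = a * \<theta> + b))"

text \<open>The descents are compared as functions of the height, the parameter shared by both
  segments, and for all heights below the common point, since candidates may fall far below the
  segments themselves. The second clause excludes overlaps.\<close>

definition coherent :: "('n::finite) edge \<Rightarrow> 'n edge \<Rightarrow> bool"
  where "coherent e e' \<longleftrightarrow>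
    (\<forall>x \<in> seg e \<inter> seg e'. height e (coord e x) = height e' (coord e' x) \<and>
       (\<forall>h \<le> height e (coord e x). point_at e h = point_at e' h)) \<and>
    (\<forall>x \<in> seg e \<inter> seg e'. \<forall>y \<in> seg e \<inter> seg e'. x = y)"

definition int_tree :: "(real ^ 'n::finite) set \<Rightarrow> 'n edge set \<Rightarrow> bool"
  where "int_tree P F \<longleftrightarrow> finite F \<and> F \<noteq> {} \<and> P = (\<Union>e\<in>F. seg e) \<and> (\<forall>e\<in>F. is_edge P e) \<and>
    (\<forall>e\<in>F. \<forall>e'\<in>F. e \<noteq> e' \<longrightarrow> coherent e e')"

lemma coord_origin: "is_edge P e \<Longrightarrow> coord e (origin e + \<theta> *\<^sub>R direction e) = \<theta>"
  by (simp add: coord_def is_edge_def)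

lemma seg_coord:
  assumes "is_edge P e" "x \<in> seg e"
  shows "low e \<le> coord e x" "coord e x \<le> high e" "origin e + coord e x *\<^sub>R direction e = x"
  using assms coord_origin[OF assms(1)] unfolding seg_def by auto

lemma height_mono: "is_edge P e \<Longrightarrow> s \<le> t \<Longrightarrow> height e s \<le> height e t"
  unfolding is_edge_def height_def by (simp add: mult_left_mono)

lemma point_at_height: "is_edge P e \<Longrightarrow> point_at e (height e \<theta>) = descent e \<theta>"
  by (simp add: point_at_def height_def is_edge_def)

lemma height_inverse: "is_edge P e \<Longrightarrow> height e ((h - shift e) / slope e) = h"
  by (simp add: height_def is_edge_def)

lemma height_nonneg:
  assumes "is_edge P e" "x \<in> seg e"
  shows "0 \<le> height e (coord e x)"
proof -
  have "0 \<le> height e (low e)" using assms by (simp add: is_edge_def)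
  also have "\<dots> \<le> height e (coord e x)"
    using assms by (metis seg_coord(1) height_mono)
  finally show ?thesis .
qed

lemma descent_coord: "is_edge P e \<Longrightarrow> x \<in> seg e \<Longrightarrow> descent e (coord e x) = x"
  using seg_coord[of P e x] by (auto simp: is_edge_def)

section \<open>Integral distance to a segment and separation of two segments\<close>

lemma height_coord_lipschitz:
  assumes "is_edge P e"
  shows "\<bar>height e (coord e x) - height e (coord e y)\<bar> \<le> slope e * norm (functional e) * norm (x - y)"
proof -
  have "height e (coord e x) - height e (coord e y) = slope e * (functional e \<bullet> (x - y))"
    by (simp add: height_def coord_def algebra_simps inner_diff_right)
  then show ?thesis
    using assms Cauchy_Schwarz_ineq2[of "functional e" "x - y"]
    by (simp add: abs_mult is_edge_def mult_left_mono mult.assoc)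
qed

lemma compact_seg: "compact (seg e)"
  unfolding seg_def by (intro compact_continuous_image continuous_intros compact_Icc)

text \<open>\<open>d\<close> replaces the Euclidean distance to the segment by an integral function:
  the l1 norm of the part of \<open>x - z\<close> off the line, plus the overshoot beyond either
  end. The ends are rational, hence the overshoots are multiplied by a common denominator
  \<open>m\<close>. Since \<open>d\<close> dominates the overshoot beyond \<open>b\<close>, the
  coordinate minus \<open>d\<close> never passes the upper end, above which nothing is known of the
  descent.\<close>

lemma line_distance:
  fixes z c \<phi> :: "real ^ 'n"
  assumes "int_vec z" "int_vec c" "int_vec \<phi>" "\<phi> \<bullet> c = 1" "a \<in> \<rat>" "b \<in> \<rat>" "a \<le> b"
  obtains d :: "real ^ 'n \<Rightarrow> real" and C :: real where
    "C > 0" "\<And>x. 0 \<le> d x" "\<And>\<theta>. \<theta> \<in> {a..b} \<Longrightarrow> d (z + \<theta> *\<^sub>R c) = 0"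
    "\<And>x. \<exists>\<theta>\<in>{a..b}. norm (x - (z + \<theta> *\<^sub>R c)) \<le> C * d x"
    "\<And>x. \<phi> \<bullet> (x - z) - d x \<le> b"
    "\<And>S. piecewise_int_linear_on S d" "continuous_on UNIV d"
proof -
  obtain m :: nat where m: "m > 0" "\<And>x. x \<in> {a, b} \<Longrightarrow> real m * x \<in> \<int>"
    using Rats_common_denominator[of "{a, b}"] assms by auto
  then have mab: "real m * a \<in> \<int>" "real m * b \<in> \<int>" by auto
  define \<tau> where "\<tau> x = \<phi> \<bullet> (x - z)" for x
  define s where "s x = (\<Sum>j\<in>UNIV. \<bar>(x - z - \<tau> x *\<^sub>R c) $ j\<bar>)" for x
  define d where "d x = s x + (max 0 (real m * \<tau> x + - (real m * b)) + max 0 (real m * a + (- real m) * \<tau> x))" for x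
  have s0: "0 \<le> s x" for x unfolding s_def by (simp add: sum_nonneg)
  have ends: "\<tau> x - b \<le> max 0 (real m * \<tau> x + - (real m * b))"
             "a - \<tau> x \<le> max 0 (real m * a + (- real m) * \<tau> x)" for x
  proof -
    have "r \<le> max 0 (real m * r)" for r :: real
      using m mult_right_mono[of 1 "real m" r] by (cases "r \<ge> 0") auto
    from this[of "\<tau> x - b"] this[of "a - \<tau> x"]
    show "\<tau> x - b \<le> max 0 (real m * \<tau> x + - (real m * b))"
      "a - \<tau> x \<le> max 0 (real m * a + (- real m) * \<tau> x)"
      by (auto simp: algebra_simps)
  qed
  show ?thesis
  proof (rule that[of "1 + norm c" d])
    show "0 < 1 + norm c" by (simp add: add_pos_nonneg)
    show "0 \<le> d x" for x using s0[of x] by (simp add: d_def add_nonneg_nonneg)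
    show "d (z + \<theta> *\<^sub>R c) = 0" if "\<theta> \<in> {a..b}" for \<theta>
    proof -
      have "\<tau> (z + \<theta> *\<^sub>R c) = \<theta>" using assms by (simp add: \<tau>_def)
      then show ?thesis using that m by (simp add: d_def s_def mult_left_mono)
    qed
    show "\<exists>\<theta>\<in>{a..b}. norm (x - (z + \<theta> *\<^sub>R c)) \<le> (1 + norm c) * d x" for x
    proof (rule bexI[of _ "max a (min b (\<tau> x))"])
      let ?\<theta> = "max a (min b (\<tau> x))"
      have "norm (x - (z + ?\<theta> *\<^sub>R c)) = norm ((x - z - \<tau> x *\<^sub>R c) + (\<tau> x - ?\<theta>) *\<^sub>R c)"
        by (simp add: algebra_simps)
      also have "\<dots> \<le> norm (x - z - \<tau> x *\<^sub>R c) + \<bar>\<tau> x - ?\<theta>\<bar> * norm c"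
        using norm_triangle_ineq by (metis norm_scaleR)
      also have "norm (x - z - \<tau> x *\<^sub>R c) \<le> s x"
        unfolding s_def by (rule norm_le_l1_cart)
      also have "s x \<le> d x" by (simp add: d_def)
      also have "\<bar>\<tau> x - ?\<theta>\<bar> \<le> max 0 (\<tau> x - b) + max 0 (a - \<tau> x)"
        using \<open>a \<le> b\<close> by (auto simp: max_def min_def)
      also have "\<dots> \<le> d x" using ends[of x] s0[of x] by (simp add: d_def)
      finally show "norm (x - (z + ?\<theta> *\<^sub>R c)) \<le> (1 + norm c) * d x"
        by (simp add: algebra_simps mult_right_mono)
    qed (use \<open>a \<le> b\<close> in auto)
    show "\<phi> \<bullet> (x - z) - d x \<le> b" for x
      using ends(1)[of x] s0[of x] by (simp add: d_def \<tau>_def)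
    have \<tau>: "\<tau> = (\<lambda>x. \<phi> \<bullet> x + - (\<phi> \<bullet> z))" by (auto simp: \<tau>_def inner_diff_right)
    have pil_\<tau>: "piecewise_int_linear_on S \<tau>" for S
      unfolding \<tau> using assms by (intro pil_affine) (auto intro: int_vec_inner)
    have "piecewise_int_linear_on S (\<lambda>x. (x - z - \<tau> x *\<^sub>R c) $ j)" for S j
    proof -
      have "(\<lambda>x. (x - z - \<tau> x *\<^sub>R c) $ j) = (\<lambda>x. (axis j 1 \<bullet> x + - (z $ j)) + (- (c $ j)) * \<tau> x)"
        by (auto simp: inner_axis' algebra_simps)
      moreover have "piecewise_int_linear_on S (\<lambda>x. (axis j 1 \<bullet> x + - (z $ j)) + (- (c $ j)) * \<tau> x)"
        using assms(1,2) by (intro pil_add pil_scale pil_\<tau> pil_affine int_vec_axis) (auto simp: int_vec_def)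
      ultimately show ?thesis by simp
    qed
    then have "piecewise_int_linear_on S s" for S
      unfolding s_def by (intro pil_sum pil_abs) auto
    then show "piecewise_int_linear_on S d" for S
      unfolding d_def using mab
      by (intro pil_add pil_max pil_const pil_scale pil_\<tau>) auto
    show "continuous_on UNIV d"
      unfolding d_def s_def \<tau>_def by (intro continuous_intros)
  qed
qed

text \<open>If the directions are independent, \<open>u\<close> has positive distance to the line of
  \<open>w\<close>, and scaling gives the bound. If they are parallel, the hypothesis puts the
  segments on opposite sides of the common point, so the distance grows at least by
  \<open>norm u\<close> per unit of \<open>s\<close>.\<close>

lemma segments_transversal:
  fixes u w :: "'a :: euclidean_space"
  assumes "convex I" "0 \<in> I" "convex J" "0 \<in> J" "u \<noteq> 0" "w \<noteq> 0"
    and common: "\<And>s t. s \<in> I \<Longrightarrow> t \<in> J \<Longrightarrow> s *\<^sub>R u = t *\<^sub>R w \<Longrightarrow> s = 0"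
  obtains c :: real where "c > 0" "\<And>s t. s \<in> I \<Longrightarrow> t \<in> J \<Longrightarrow> c * \<bar>s\<bar> \<le> norm (s *\<^sub>R u - t *\<^sub>R w)"
proof (cases "u \<in> span {w}")
  case False
  have "open (- span {w})" by (simp add: open_Compl closed_span)
  then obtain c where c: "c > 0" "ball u c \<subseteq> - span {w}"
    using False by (meson ComplI open_contains_ball)
  have "c * \<bar>s\<bar> \<le> norm (s *\<^sub>R u - t *\<^sub>R w)" for s t
  proof (cases "s = 0")
    case s: False
    have "(t / s) *\<^sub>R w \<in> span {w}" by (simp add: span_mul span_base)
    then have "(t / s) *\<^sub>R w \<notin> ball u c" using c by blast
    then have "c \<le> norm (u - (t / s) *\<^sub>R w)" by (simp add: dist_norm)
    then have "c * \<bar>s\<bar> \<le> norm (u - (t / s) *\<^sub>R w) * \<bar>s\<bar>" by (simp add: mult_right_mono)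
    also have "\<dots> = norm (s *\<^sub>R (u - (t / s) *\<^sub>R w))" by simp
    also have "s *\<^sub>R (u - (t / s) *\<^sub>R w) = s *\<^sub>R u - t *\<^sub>R w" using s by (simp add: algebra_simps)
    finally show ?thesis .
  qed auto
  then show ?thesis using that c(1) by blast
next
  case True
  then obtain k where k: "u = k *\<^sub>R w" by (auto simp: span_singleton)
  have k0: "k \<noteq> 0" using k \<open>u \<noteq> 0\<close> by auto
  have scale: "r * s \<in> I" if "0 \<le> r" "r \<le> 1" "s \<in> I" for r s
    using convexD_alt[OF \<open>convex I\<close> \<open>0 \<in> I\<close> \<open>s \<in> I\<close>, of r] that by simp
  have scale': "r * s \<in> J" if "0 \<le> r" "r \<le> 1" "s \<in> J" for r s
    using convexD_alt[OF \<open>convex J\<close> \<open>0 \<in> J\<close> \<open>s \<in> J\<close>, of r] that by simp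
  have "norm u * \<bar>s\<bar> \<le> norm (s *\<^sub>R u - t *\<^sub>R w)" if st: "s \<in> I" "t \<in> J" for s t
  proof -
    \<comment> \<open>On the same side, shrinking the longer of the two towards 0, which convexity
      permits, would produce a second common point.\<close>
    have opp: "(s * k) * t \<le> 0"
    proof (rule ccontr)
      assume "\<not> (s * k) * t \<le> 0"
      then have pos: "(s * k) * t > 0" by simp
      then have nz: "s \<noteq> 0" "t \<noteq> 0" by auto
      show False
      proof (cases "\<bar>t\<bar> \<le> \<bar>s * k\<bar>")
        case True
        let ?r = "t / (s * k)"
        have "?r > 0" using pos by (metis mult.commute zero_less_divide_iff zero_less_mult_iff)
        moreover have "\<bar>?r\<bar> \<le> 1" using True nz k0 by (simp add: abs_divide)
        ultimately have "?r * s \<in> I" using scale[OF _ _ st(1), of ?r] by linarith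
        moreover have "(?r * s) *\<^sub>R u = t *\<^sub>R w" using k nz k0 by simp
        ultimately have "?r * s = 0" using common st by blast
        then show False using nz k0 by simp
      next
        case False
        let ?r = "(s * k) / t"
        have "?r > 0" using pos by (metis zero_less_divide_iff zero_less_mult_iff)
        moreover have "\<bar>?r\<bar> \<le> 1" using False nz k0 by (simp add: abs_divide)
        ultimately have "?r * t \<in> J" using scale'[OF _ _ st(2), of ?r] by linarith
        moreover have "s *\<^sub>R u = (?r * t) *\<^sub>R w" using k nz k0 by simp
        ultimately have "s = 0" using common st by blast
        then show False using nz by simp
      qed
    qed
    have "\<bar>r\<bar> \<le> \<bar>r - t\<bar>" if "r * t \<le> 0" for r
      using that by (auto simp: mult_le_0_iff)
    from this[OF opp] have "\<bar>s * k\<bar> \<le> \<bar>s * k - t\<bar>" .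
    then have "\<bar>s * k\<bar> * norm w \<le> \<bar>s * k - t\<bar> * norm w" by (simp add: mult_right_mono)
    also have "\<dots> = norm (s *\<^sub>R u - t *\<^sub>R w)"
      by (simp add: k flip: scaleR_diff_left)
    finally show ?thesis by (simp add: k abs_mult algebra_simps)
  qed
  then show ?thesis using that[of "norm u"] \<open>u \<noteq> 0\<close> by simp
qed

lemma seg_translate:
  assumes e: "is_edge P e" and p: "p \<in> seg e" and y: "y \<in> seg e"
  obtains s where "s \<in> {low e - coord e p..high e - coord e p}" "y = p + s *\<^sub>R direction e"
proof -
  have "p + (coord e y - coord e p) *\<^sub>R direction e
      = (origin e + coord e p *\<^sub>R direction e) + (coord e y - coord e p) *\<^sub>R direction e"
    using seg_coord(3)[OF e p] by simp
  also have "\<dots> = y" using seg_coord(3)[OF e y] by (simp add: scaleR_diff_left)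
  finally have "y = p + (coord e y - coord e p) *\<^sub>R direction e" by simp
  then show ?thesis using that[of "coord e y - coord e p"] seg_coord[OF e y] by auto
qed

lemma direction_nonzero: "is_edge P e \<Longrightarrow> direction e \<noteq> 0"
  by (auto simp: is_edge_def)

text \<open>The bounds are linear in \<open>d + d'\<close> because a multiple of these distances is
  what the penalty provides. Disjoint compact segments cannot both be near \<open>x\<close>; if they
  meet, a point near both is near the common point, as the segments diverge from it at a linear
  rate.\<close>

lemma edge_separation:
  assumes e: "is_edge P e" and e': "is_edge P e'"
    and "C > 0" "C' > 0" and d0: "\<And>x. 0 \<le> d x" "\<And>x. 0 \<le> d' x"
    and d: "\<And>x. \<exists>y\<in>seg e. norm (x - y) \<le> C * d x"
    and d': "\<And>x. \<exists>y\<in>seg e'. norm (x - y) \<le> C' * d' x"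
    and unique: "\<And>x y. x \<in> seg e \<inter> seg e' \<Longrightarrow> y \<in> seg e \<inter> seg e' \<Longrightarrow> x = y"
  obtains K where "K > 0" "\<And>x. 1 \<le> K * (d x + d' x)"
  | K p where "K > 0" "p \<in> seg e \<inter> seg e'" "\<And>x. norm (x - p) \<le> K * (d x + d' x)"
proof -
  have near: "C * d x + C' * d' x \<le> (C + C') * (d x + d' x)" for x
    using d0[of x] \<open>C > 0\<close> \<open>C' > 0\<close> by (simp add: algebra_simps)
  show ?thesis
  proof (cases "seg e \<inter> seg e' = {}")
    case True
    then obtain c where c: "c > 0" "\<And>y y'. y \<in> seg e \<Longrightarrow> y' \<in> seg e' \<Longrightarrow> c \<le> dist y y'"
      using separate_compact_closed[OF compact_seg compact_imp_closed[OF compact_seg]] by metis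
    have "1 \<le> (C + C') / c * (d x + d' x)" for x
    proof -
      obtain y y' where y: "y \<in> seg e" "norm (x - y) \<le> C * d x" "y' \<in> seg e'" "norm (x - y') \<le> C' * d' x"
        using d d' by meson
      have "c \<le> norm (x - y) + norm (x - y')"
        using c(2)[OF y(1,3)] dist_triangle3[of y y' x] by (simp add: dist_norm)
      also have "\<dots> \<le> (C + C') * (d x + d' x)" using y near[of x] by linarith
      finally show ?thesis using c by (simp add: field_simps)
    qed
    then show ?thesis using that(1)[of "(C + C') / c"] c \<open>C > 0\<close> \<open>C' > 0\<close> by simp
  next
    case False
    then obtain p where p: "p \<in> seg e" "p \<in> seg e'" by blast
    let ?u = "direction e" and ?w = "direction e'"
    let ?I = "{low e - coord e p..high e - coord e p}" and ?J = "{low e' - coord e' p..high e' - coord e' p}"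
    have in_seg: "p + s *\<^sub>R ?u \<in> seg e" if "s \<in> ?I" for s
    proof -
      have "p + s *\<^sub>R ?u = origin e + (coord e p + s) *\<^sub>R ?u"
        unfolding scaleR_add_left add.assoc[symmetric] seg_coord(3)[OF e p(1)] ..
      then show ?thesis using that unfolding seg_def by auto
    qed
    have in_seg': "p + s *\<^sub>R ?w \<in> seg e'" if "s \<in> ?J" for s
    proof -
      have "p + s *\<^sub>R ?w = origin e' + (coord e' p + s) *\<^sub>R ?w"
        unfolding scaleR_add_left add.assoc[symmetric] seg_coord(3)[OF e' p(2)] ..
      then show ?thesis using that unfolding seg_def by auto
    qed
    obtain c where c: "c > 0" "\<And>s t. s \<in> ?I \<Longrightarrow> t \<in> ?J \<Longrightarrow> c * \<bar>s\<bar> \<le> norm (s *\<^sub>R ?u - t *\<^sub>R ?w)"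
    proof (rule segments_transversal[of ?I ?J ?u ?w])
      show "0 \<in> ?I" using seg_coord[OF e p(1)] by auto
      show "0 \<in> ?J" using seg_coord[OF e' p(2)] by auto
      show "?u \<noteq> 0" "?w \<noteq> 0" using direction_nonzero e e' by auto
      fix s t assume st: "s \<in> ?I" "t \<in> ?J" "s *\<^sub>R ?u = t *\<^sub>R ?w"
      then have "p + s *\<^sub>R ?u \<in> seg e \<inter> seg e'" using in_seg in_seg' by (metis IntI)
      then have "p + s *\<^sub>R ?u = p" using unique p by blast
      then show "s = 0" using \<open>?u \<noteq> 0\<close> by simp
    qed auto
    let ?B = "1 + norm ?u / c"
    have B: "?B > 0" using c by (simp add: add_pos_nonneg)
    have "norm (x - p) \<le> (?B * (C + C')) * (d x + d' x)" for x
    proof -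
      obtain y y' where y: "y \<in> seg e" "norm (x - y) \<le> C * d x" "y' \<in> seg e'" "norm (x - y') \<le> C' * d' x"
        using d d' by meson
      obtain s where s: "s \<in> ?I" "y = p + s *\<^sub>R ?u" using seg_translate[OF e p(1) y(1)] by blast
      obtain t where t: "t \<in> ?J" "y' = p + t *\<^sub>R ?w" using seg_translate[OF e' p(2) y(3)] by blast
      have "c * \<bar>s\<bar> \<le> norm (y - y')" using c(2)[OF s(1) t(1)] s t by simp
      then have "\<bar>s\<bar> * norm ?u \<le> norm (y - y') / c * norm ?u"
        using c by (intro mult_right_mono) (auto simp: field_simps)
      then have "norm (y - p) \<le> norm ?u / c * norm (y - y')" using s by (simp add: field_simps)
      moreover have yy: "norm (y - y') \<le> norm (x - y) + norm (x - y')"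
        using dist_triangle3[of y y' x] by (simp add: dist_norm)
      moreover have "norm (x - p) \<le> norm (x - y) + norm (y - p)"
        using norm_triangle_ineq[of "x - y" "y - p"] by simp
      ultimately have "norm (x - p) \<le> norm (x - y) + norm ?u / c * (norm (x - y) + norm (x - y'))"
        using c mult_left_mono[OF yy, of "norm ?u / c"] by simp
      also have "\<dots> \<le> ?B * (norm (x - y) + norm (x - y'))" by (simp add: algebra_simps)
      also have "\<dots> \<le> ?B * ((C + C') * (d x + d' x))"
        using B y near[of x] by (intro mult_left_mono) auto
      finally show ?thesis by (simp add: mult.assoc)
    qed
    then show ?thesis using that(2)[of "?B * (C + C')" p] B p \<open>C > 0\<close> \<open>C' > 0\<close> by simp
  qed
qed

text \<open>The penalties lower the two heights by at least \<open>M * d x\<close> and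
  \<open>M * d' x\<close>, together at least twice the error made in replacing \<open>x\<close> by
  the common point \<open>p\<close>. So the two heights add up to at most twice the height of
  \<open>p\<close>; when equal, they are at or below it, where the descents agree. For disjoint
  segments the sum is nonpositive and both descents have reached the root. On \<open>e\<close>
  itself the whole penalty falls on \<open>e'\<close>, which is what makes the retraction fix
  \<open>P\<close>.\<close>

lemma coherent_retraction_pair:
  assumes e: "is_edge P e" and e': "is_edge P e'" and coh: "coherent e e'"
    and "C > 0" "C' > 0" and d0: "\<And>x. 0 \<le> d x" "\<And>x. 0 \<le> d' x"
    and d: "\<And>x. \<exists>y\<in>seg e. norm (x - y) \<le> C * d x"
    and d': "\<And>x. \<exists>y\<in>seg e'. norm (x - y) \<le> C' * d' x"
    and dz: "\<And>x. x \<in> seg e \<Longrightarrow> d x = 0"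
    and "bounded S"
  shows "\<forall>\<^sub>F M in at_top. \<forall>x\<in>S.
      (height e (coord e x - M * d x) = height e' (coord e' x - M * d' x) \<longrightarrow>
        descent e (coord e x - M * d x) = descent e' (coord e' x - M * d' x)) \<and>
      (x \<in> seg e \<longrightarrow> height e' (coord e' x - M * d' x) \<le> height e (coord e x))"
proof -
  define f where "f M x = height e (coord e x - M * d x)" for M x
  define f' where "f' M x = height e' (coord e' x - M * d' x)" for M x
  \<comment> \<open>A positive integer is at least 1, so lowering a coordinate lowers the height by
    at least as much.\<close>
  have slope: "1 \<le> slope e" "1 \<le> slope e'"
    using e e' unfolding is_edge_def by (auto elim!: Ints_cases)
  have f: "f M x \<le> height e (coord e x) - M * d x" if "M \<ge> 0" for M x
    using mult_right_mono[OF slope(1), of "M * d x"] that d0(1)[of x]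
    by (simp add: f_def height_def algebra_simps)
  have f': "f' M x \<le> height e' (coord e' x) - M * d' x" if "M \<ge> 0" for M x
    using mult_right_mono[OF slope(2), of "M * d' x"] that d0(2)[of x]
    by (simp add: f'_def height_def algebra_simps)
  have pt: "descent e (coord e x - M * d x) = point_at e (f M x)"
    "descent e' (coord e' x - M * d' x) = point_at e' (f' M x)" for M x
    using point_at_height[OF e] point_at_height[OF e'] by (simp_all add: f_def f'_def)
  define L where "L = slope e * norm (functional e) + slope e' * norm (functional e')"
  have L0: "L \<ge> 0" using slope by (simp add: L_def)
  have L: "\<bar>height e (coord e x) - height e (coord e y)\<bar> \<le> L * norm (x - y)"
    "\<bar>height e' (coord e' x) - height e' (coord e' y)\<bar> \<le> L * norm (x - y)" for x y
  proof -
    have "slope e * norm (functional e) * norm (x - y) \<le> L * norm (x - y)"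
      "slope e' * norm (functional e') * norm (x - y) \<le> L * norm (x - y)"
      using slope by (auto intro!: mult_right_mono simp: L_def)
    then show "\<bar>height e (coord e x) - height e (coord e y)\<bar> \<le> L * norm (x - y)"
      "\<bar>height e' (coord e' x) - height e' (coord e' y)\<bar> \<le> L * norm (x - y)"
      using height_coord_lipschitz[OF e, of x y] height_coord_lipschitz[OF e', of x y] by linarith+
  qed
  have zero: "point_at e h = 1 \<and> point_at e' h = 1" if "h \<le> 0" for h
  proof -
    have "(h - shift e) / slope e \<le> high e"
    proof -
      have "height e ((h - shift e) / slope e) \<le> height e (low e)"
        using e that height_inverse[OF e, of h] by (simp add: is_edge_def)
      also have "\<dots> \<le> height e (high e)" using e height_mono[OF e, of "low e" "high e"] by (simp add: is_edge_def)
      finally show ?thesis using slope by (simp add: height_def pos_divide_le_eq mult.commute)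
    qed
    moreover have "(h - shift e') / slope e' \<le> high e'"
    proof -
      have "height e' ((h - shift e') / slope e') \<le> height e' (low e')"
        using e' that height_inverse[OF e', of h] by (simp add: is_edge_def)
      also have "\<dots> \<le> height e' (high e')" using e' height_mono[OF e', of "low e'" "high e'"] by (simp add: is_edge_def)
      finally show ?thesis using slope by (simp add: height_def pos_divide_le_eq mult.commute)
    qed
    ultimately show ?thesis
      using that height_inverse[OF e, of h] height_inverse[OF e', of h] e e'
      unfolding point_at_def is_edge_def by auto
  qed
  have "\<forall>\<^sub>F M in at_top. \<forall>x\<in>S. (f M x = f' M x \<longrightarrow> point_at e (f M x) = point_at e' (f' M x)) \<and>
      (x \<in> seg e \<longrightarrow> f' M x \<le> height e (coord e x))"
  proof (rule edge_separation[OF e e' \<open>C > 0\<close> \<open>C' > 0\<close> d0 d d'])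
    show "x = y" if "x \<in> seg e \<inter> seg e'" "y \<in> seg e \<inter> seg e'" for x y
      using coh that unfolding coherent_def by blast
  next
    fix K :: real assume K: "K > 0" "\<And>x. 1 \<le> K * (d x + d' x)"
    obtain B where B: "\<And>x. x \<in> S \<Longrightarrow> norm x \<le> B" "B > 0"
      using \<open>bounded S\<close> bounded_pos by blast
    define R where "R = L * B + \<bar>height e (coord e 0)\<bar> + \<bar>height e' (coord e' 0)\<bar>"
    have R: "height e (coord e x) \<le> R" "height e' (coord e' x) \<le> R" if "x \<in> S" for x
      using L[of x 0] mult_left_mono[OF B(1)[OF that] L0] by (simp_all add: R_def)
    have R0: "R \<ge> 0" using L0 B by (simp add: R_def)
    \<comment> \<open>\<open>R\<close> bounds both heights on \<open>S\<close>, and the threshold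
      makes the penalties add up to at least \<open>2 * R\<close>.\<close>
    have "(f M x = f' M x \<longrightarrow> point_at e (f M x) = point_at e' (f' M x)) \<and>
        (x \<in> seg e \<longrightarrow> f' M x \<le> height e (coord e x))" if M: "M \<ge> 2 * R * K" and "x \<in> S" for M x
    proof -
      have M0: "M \<ge> 0" using M R0 K(1) by (meson mult_nonneg_nonneg order_trans zero_le_numeral less_imp_le)
      have "2 * R \<le> 2 * R * (K * (d x + d' x))"
        using mult_left_mono[OF K(2)[of x], of "2 * R"] R0 by simp
      also have "\<dots> \<le> M * (d x + d' x)"
        using mult_right_mono[OF M, of "d x + d' x"] d0[of x] by (simp add: mult.assoc)
      finally have sum: "2 * R \<le> M * d x + M * d' x" by (simp add: algebra_simps)
      show ?thesis
      proof (intro conjI impI)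
        assume "f M x = f' M x"
        moreover have "f M x + f' M x \<le> 0"
          using f[OF M0, of x] f'[OF M0, of x] R[OF \<open>x \<in> S\<close>] sum by linarith
        ultimately show "point_at e (f M x) = point_at e' (f' M x)"
          using zero[of "f M x"] by simp
      next
        assume x: "x \<in> seg e"
        have "f' M x \<le> 0" using f'[OF M0, of x] R[OF \<open>x \<in> S\<close>] sum dz[OF x] R0 by simp
        then show "f' M x \<le> height e (coord e x)" using height_nonneg[OF e x] by linarith
      qed
    qed
    then show ?thesis by (intro eventually_at_top_linorderI[of "2 * R * K"]) blast
  next
    fix K p assume K: "K > 0" "p \<in> seg e \<inter> seg e'" "\<And>x. norm (x - p) \<le> K * (d x + d' x)"
    define h where "h = height e (coord e p)"
    have h: "h = height e' (coord e' p)" "\<And>k. k \<le> h \<Longrightarrow> point_at e k = point_at e' k"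
      using coh K(2) unfolding coherent_def h_def by blast+
    \<comment> \<open>Both heights at \<open>x\<close> are at most
      \<open>h + L * norm (x - p)\<close>, and the threshold makes the penalties add up to at least
      twice the second term.\<close>
    have "(f M x = f' M x \<longrightarrow> point_at e (f M x) = point_at e' (f' M x)) \<and>
        (x \<in> seg e \<longrightarrow> f' M x \<le> height e (coord e x))" if M: "M \<ge> 2 * L * K" and "x \<in> S" for M x
    proof -
      have M0: "M \<ge> 0" using M L0 K(1) by (meson mult_nonneg_nonneg order_trans zero_le_numeral less_imp_le)
      have "2 * L * norm (x - p) \<le> 2 * L * (K * (d x + d' x))"
        using mult_left_mono[OF K(3)[of x], of "2 * L"] L0 by simp
      also have "\<dots> \<le> M * (d x + d' x)"
        using mult_right_mono[OF M, of "d x + d' x"] d0[of x] by (simp add: mult.assoc)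
      finally have sum: "2 * (L * norm (x - p)) \<le> M * d x + M * d' x" by (simp add: algebra_simps)
      have lip: "height e (coord e x) \<le> h + L * norm (x - p)" "height e' (coord e' x) \<le> h + L * norm (x - p)"
        "h - L * norm (x - p) \<le> height e (coord e x)"
        using L[of x p] h(1) unfolding h_def by linarith+
      show ?thesis
      proof (intro conjI impI)
        assume "f M x = f' M x"
        moreover have "f M x + f' M x \<le> 2 * h"
          using f[OF M0, of x] f'[OF M0, of x] lip sum by linarith
        ultimately show "point_at e (f M x) = point_at e' (f' M x)"
          using h(2)[of "f M x"] by simp
      next
        assume x: "x \<in> seg e"
        show "f' M x \<le> height e (coord e x)"
          using f'[OF M0, of x] lip sum dz[OF x] by simp
      qed
    qed
    then show ?thesis by (intro eventually_at_top_linorderI[of "2 * L * K"]) blast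
  qed
  then show ?thesis unfolding pt f_def f'_def .
qed

section \<open>Assembling the retraction from the segments\<close>

lemma pil_descent:
  assumes e: "is_edge P e" and g: "piecewise_int_linear_on S g" and high: "\<And>x. x \<in> S \<Longrightarrow> g x \<le> high e"
  shows "piecewise_int_linear_on S (\<lambda>x. descent e (g x) $ j)"
proof -
  obtain K where K: "finite K" "K \<subseteq> \<int> \<times> \<int>" "\<forall>\<theta>\<le>high e. \<forall>j. \<exists>(a, b)\<in>K. descent e \<theta> $ j = a * \<theta> + b"
    using e unfolding is_edge_def by blast
  show ?thesis
  proof (rule pil_select[where I = K and f = "\<lambda>(a, b) x. a * g x + b"])
    show "piecewise_int_linear_on S ((\<lambda>(a, b) x. a * g x + b) i)" if "i \<in> K" for i
      using that K(2) by (auto intro!: pil_add pil_scale g pil_const)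
    show "\<exists>i\<in>K. descent e (g x) $ j = (\<lambda>(a, b) x. a * g x + b) i x" if "x \<in> S" for x
    proof -
      have "g x \<le> high e" by (rule high[OF that])
      then obtain a b where "(a, b) \<in> K" "descent e (g x) $ j = a * g x + b"
        using K(3) by blast
      then show ?thesis by (intro bexI[of _ "(a, b)"]) auto
    qed
  qed (rule K(1))
qed

lemma edge_distance:
  assumes "is_edge P e"
  obtains d C where "C > 0" "\<And>x. 0 \<le> d x" "\<And>x. x \<in> seg e \<Longrightarrow> d x = 0"
    "\<And>x. \<exists>y\<in>seg e. norm (x - y) \<le> C * d x"
    "\<And>x. coord e x - d x \<le> high e"
    "\<And>S. piecewise_int_linear_on S d" "continuous_on UNIV d"
proof -
  have "int_vec (origin e)" "int_vec (direction e)" "int_vec (functional e)"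
    "functional e \<bullet> direction e = 1" "low e \<in> \<rat>" "high e \<in> \<rat>" "low e \<le> high e"
    using assms by (auto simp: is_edge_def)
  then show thesis
    by (rule line_distance) (rule that; auto simp: seg_def coord_def)
qed

lemma pil_coord: "is_edge P e \<Longrightarrow> piecewise_int_linear_on S (coord e)"
  using pil_affine[of "functional e" "- (functional e \<bullet> origin e)" S]
  by (auto simp: is_edge_def coord_def[abs_def] inner_diff_right intro: int_vec_inner)

text \<open>Each point follows a segment of largest candidate height. Tied candidates give the same
  point, so the continuous descents on the closed sets \<open>A e\<close>, where \<open>e\<close> is
  maximal, can be glued. A point of \<open>P\<close> is won by a segment containing it, on which it
  incurs no penalty.\<close>

lemma int_tree_retract:
  assumes T: "int_tree P F" and P: "P \<subseteq> unit_cube"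
  shows "pointed_Z_retract P"
proof -
  have F: "finite F" "F \<noteq> {}" "P = (\<Union>e\<in>F. seg e)" "\<And>e. e \<in> F \<Longrightarrow> is_edge P e"
    "\<And>e e'. e \<in> F \<Longrightarrow> e' \<in> F \<Longrightarrow> e \<noteq> e' \<Longrightarrow> coherent e e'"
    using T unfolding int_tree_def by auto
  have "\<forall>e\<in>F. \<exists>dC :: (real ^ 'a \<Rightarrow> real) \<times> real. snd dC > 0 \<and> (\<forall>x. 0 \<le> fst dC x) \<and> (\<forall>x\<in>seg e. fst dC x = 0) \<and>
    (\<forall>x. \<exists>y\<in>seg e. norm (x - y) \<le> snd dC * fst dC x) \<and> (\<forall>x. coord e x - fst dC x \<le> high e) \<and>
    (\<forall>S. piecewise_int_linear_on S (fst dC)) \<and> continuous_on UNIV (fst dC)"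
    (is "\<forall>e\<in>F. \<exists>dC. ?Q e dC")
  proof
    fix e assume "e \<in> F"
    show "\<exists>dC. ?Q e dC"
      by (rule edge_distance[OF F(4)[OF \<open>e \<in> F\<close>]], rule_tac x = "(d, C)" in exI) auto
  qed
  then obtain dC where dC: "\<forall>e\<in>F. ?Q e (dC e)" by (rule bchoice[elim_format]) blast
  define d where "d e = fst (dC e)" for e
  define C where "C e = snd (dC e)" for e
  have d: "C e > 0" "\<And>x. 0 \<le> d e x" "\<And>x. x \<in> seg e \<Longrightarrow> d e x = 0"
    "\<And>x. \<exists>y\<in>seg e. norm (x - y) \<le> C e * d e x" "\<And>x. coord e x - d e x \<le> high e"
    "\<And>S. piecewise_int_linear_on S (d e)" "continuous_on UNIV (d e)" if "e \<in> F" for e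
    using dC that by (auto simp: d_def C_def)
  let ?R = "\<lambda>e e' M. \<forall>x\<in>unit_cube.
      (height e (coord e x - M * d e x) = height e' (coord e' x - M * d e' x) \<longrightarrow>
        descent e (coord e x - M * d e x) = descent e' (coord e' x - M * d e' x)) \<and>
      (x \<in> seg e \<longrightarrow> height e' (coord e' x - M * d e' x) \<le> height e (coord e x))"
  have pair: "\<forall>\<^sub>F M in at_top. ?R e e' M" if "e \<in> F" "e' \<in> F" for e e'
  proof (cases "e = e'")
    case True
    then show ?thesis using d[OF \<open>e \<in> F\<close>] by simp
  next
    case False
    show ?thesis
      by (rule coherent_retraction_pair[OF F(4) F(4) F(5), where C = "C e" and C' = "C e'"]) (use that False d in auto)
  qed
  have "\<forall>\<^sub>F M in at_top. (\<forall>e\<in>F. \<forall>e'\<in>F. ?R e e' M) \<and> M \<ge> 1"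
    using pair by (intro eventually_conj eventually_ball_finite[OF F(1)] ballI eventually_ge_at_top)
  \<comment> \<open>The factor is taken to be an integer, so that the candidate coordinates have
    integer coefficients, and at least 1, so that they stay below \<open>high e\<close>.\<close>
  then have "\<forall>\<^sub>F m in sequentially. (\<forall>e\<in>F. \<forall>e'\<in>F. ?R e e' (real m)) \<and> real m \<ge> 1"
    using filterlim_real_sequentially by (rule eventually_compose_filterlim)
  then obtain m where "(\<forall>e\<in>F. \<forall>e'\<in>F. ?R e e' (real m)) \<and> real m \<ge> 1"
    using eventually_happens' trivial_limit_sequentially by blast
  then have m: "real m \<ge> 1" "\<And>e e'. e \<in> F \<Longrightarrow> e' \<in> F \<Longrightarrow> ?R e e' (real m)" by blast+
  define \<tau> where "\<tau> e x = coord e x - real m * d e x" for e x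
  define f where "f e x = height e (\<tau> e x)" for e x
  have agree: "descent e (\<tau> e x) = descent e' (\<tau> e' x)"
    if "e \<in> F" "e' \<in> F" "x \<in> unit_cube" "f e x = f e' x" for e e' x
    using m(2)[OF that(1,2)] that(3,4) unfolding \<tau>_def f_def by blast
  have \<tau>_seg: "\<tau> e x = coord e x" if "e \<in> F" "x \<in> seg e" for e x
    using d(3)[OF that] by (simp add: \<tau>_def)
  have below: "f e' x \<le> f e x" if "e \<in> F" "e' \<in> F" "x \<in> seg e" for e e' x
    using m(2)[OF that(1,2)] that P F(3) \<tau>_seg[OF that(1,3)] unfolding \<tau>_def f_def by auto
  have high: "\<tau> e x \<le> high e" if "e \<in> F" for e x
    using d(5)[OF that, of x] mult_right_mono[OF m(1), of "d e x"] d(2)[OF that, of x] by (simp add: \<tau>_def)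
  have cont\<tau>: "continuous_on S (\<tau> e)" if "e \<in> F" for e S
    unfolding \<tau>_def coord_def
    by (intro continuous_intros continuous_on_subset[OF d(7)[OF that] subset_UNIV])
  then have contf: "continuous_on S (f e)" if "e \<in> F" for e S
    unfolding f_def height_def using that by (intro continuous_intros) auto
  have pil\<tau>: "piecewise_int_linear_on S (\<tau> e)" if "e \<in> F" for e S
    using pil_add[OF pil_coord[OF F(4)[OF that]] pil_scale[OF d(6)[OF that], of "- real m"]]
    by (simp add: \<tau>_def[abs_def])
  define A where "A e = {x \<in> unit_cube. \<forall>e'\<in>F. f e' x \<le> f e x}" for e
  define E where "E x = (SOME e. e \<in> F \<and> (\<forall>e'\<in>F. f e' x \<le> f e x))" for x
  have E: "E x \<in> F" "\<And>e'. e' \<in> F \<Longrightarrow> f e' x \<le> f (E x) x" for x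
  proof -
    have "Max ((\<lambda>e. f e x) ` F) \<in> (\<lambda>e. f e x) ` F" using F(1,2) by (intro Max_in) auto
    then obtain e where "e \<in> F" "f e x = Max ((\<lambda>e. f e x) ` F)" by auto
    then have "e \<in> F \<and> (\<forall>e'\<in>F. f e' x \<le> f e x)" using F(1) by simp
    then have "E x \<in> F \<and> (\<forall>e'\<in>F. f e' x \<le> f (E x) x)" unfolding E_def by (rule someI)
    then show "E x \<in> F" "\<And>e'. e' \<in> F \<Longrightarrow> f e' x \<le> f (E x) x" by auto
  qed
  define \<zeta> where "\<zeta> x = descent (E x) (\<tau> (E x) x)" for x
  have \<zeta>: "\<zeta> x = descent e (\<tau> e x)" if "e \<in> F" "x \<in> A e" for e x
  proof -
    have "f (E x) x = f e x" using E(1)[of x] E(2)[of e x] that unfolding A_def by (simp add: order_antisym)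
    then show ?thesis unfolding \<zeta>_def using agree[OF E(1) that(1)] that(2) unfolding A_def by blast
  qed
  have \<zeta>P: "\<zeta> x \<in> P" for x
    using F(4)[OF E(1)[of x]] high[OF E(1)[of x], of x] unfolding \<zeta>_def is_edge_def by blast
  have \<zeta>_id: "\<zeta> x = x" if "x \<in> P" for x
  proof -
    obtain e where e: "e \<in> F" "x \<in> seg e" using F(3) \<open>x \<in> P\<close> by blast
    have "x \<in> A e" unfolding A_def using below[OF e(1) _ e(2)] that P by auto
    then show ?thesis using \<zeta>[OF e(1)] \<tau>_seg[OF e] descent_coord[OF F(4) e(2)] e by simp
  qed
  have A: "(\<Union>e\<in>F. A e) = unit_cube" using E unfolding A_def by auto
  have closedA: "closed (A e)" if "e \<in> F" for e
  proof -
    have "A e = unit_cube \<inter> (\<Inter>e'\<in>F. {x. f e' x \<le> f e x})" unfolding A_def by auto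
    moreover have "closed {x. f e' x \<le> f e x}" if "e' \<in> F" for e'
      using contf[of _ UNIV] that \<open>e \<in> F\<close> by (intro closed_Collect_le) auto
    ultimately show ?thesis by (simp only:) (intro closed_Int closed_cbox closed_INT ballI)
  qed
  have "continuous_on (A e) \<zeta>" if "e \<in> F" for e
  proof -
    have "continuous_on (A e) (\<lambda>x. descent e (\<tau> e x))"
      using F(4)[OF that] high[OF that] unfolding is_edge_def
      by (intro continuous_on_compose2[OF _ cont\<tau>[OF that]]) auto
    then show ?thesis using \<zeta>[OF that] by (metis continuous_on_cong)
  qed
  then have "continuous_on unit_cube \<zeta>"
    unfolding A[symmetric] using F(1) closedA by (intro continuous_on_closed_Union) auto
  moreover have "piecewise_int_linear_on unit_cube (\<lambda>x. \<zeta> x $ j)" for j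
  proof (rule pil_select[where I = F and f = "\<lambda>e x. descent e (\<tau> e x) $ j"])
    show "piecewise_int_linear_on unit_cube (\<lambda>x. descent e (\<tau> e x) $ j)" if "e \<in> F" for e
      by (rule pil_descent[OF F(4) pil\<tau>]) (use that high in auto)
  qed (use F(1) E \<zeta>_def in auto)
  ultimately have "Z_map \<zeta>" unfolding Z_map_def using \<zeta>P P by blast
  moreover have "1 \<in> P"
  proof -
    obtain e where e: "e \<in> F" using F(2) by blast
    \<comment> \<open>A coordinate in the domain of the descent whose height is at most 0, where the
      descent has reached the root.\<close>
    let ?\<theta> = "min (high e) (- shift e / slope e)"
    have "height e ?\<theta> \<le> height e (- shift e / slope e)" by (rule height_mono[OF F(4)[OF e]]) simp
    also have "\<dots> = 0" using height_inverse[OF F(4)[OF e], of 0] by simp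
    finally have "descent e ?\<theta> = 1" using F(4)[OF e] unfolding is_edge_def by auto
    moreover have "descent e ?\<theta> \<in> P" using F(4)[OF e] unfolding is_edge_def by auto
    ultimately show ?thesis by simp
  qed
  moreover have "\<zeta> ` unit_cube = P" using \<zeta>P \<zeta>_id P by (metis image_subsetI image_eqI subsetD subsetI subset_antisym)
  ultimately show ?thesis
    unfolding pointed_Z_retract_def pointed_Z_retraction_def using \<zeta>_id \<zeta>P by blast
qed

section \<open>Building trees by attaching segments\<close>

lemma int_vec_1: "int_vec 1"
  by (simp add: int_vec_def)

text \<open>One degenerate segment at the root. Its direction is arbitrary but must be primitive, so
  a coordinate axis is taken together with its dual functional.\<close>

lemma int_tree_point: "\<exists>F. int_tree {1 :: real ^ 'n} F"
proof -
  let ?e = "\<lparr>origin = 1, direction = axis undefined 1, functional = axis undefined 1, low = 0, high = 0,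
    slope = 1, shift = 0, descent = \<lambda>_. 1\<rparr> :: 'n edge"
  have "is_edge {1} ?e"
    unfolding is_edge_def height_def
    by (auto simp: int_vec_axis inner_axis_axis int_vec_1 intro!: exI[of _ "{(0, 1)}"])
  moreover have "seg ?e = {1}" by (auto simp: seg_def)
  ultimately have "int_tree {1} {?e}" by (simp add: int_tree_def)
  then show ?thesis by blast
qed

text \<open>Clearing the denominators of \<open>q - p\<close> and dividing out the gcd gives the
  primitive direction; both factors are positive, so the orientation from \<open>p\<close> to
  \<open>q\<close> is kept and \<open>a < b\<close>. The end coordinates are rational as integral
  functionals of rational vectors.\<close>

lemma int_line_parametrization:
  fixes p q :: "real ^ 'n"
  assumes "rational_vec p" "rational_vec q" "p \<noteq> q" "int_vec z" "z = p + r *\<^sub>R (q - p)"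
  obtains c \<phi> a b where "int_vec c" "int_vec \<phi>" "\<phi> \<bullet> c = 1" "a \<in> \<rat>" "b \<in> \<rat>" "a < b"
    "p = z + a *\<^sub>R c" "q = z + b *\<^sub>R c"
proof -
  have "rational_vec (q - p)" using assms by (simp add: rational_vec_diff)
  then obtain m :: nat where m: "m > 0" "\<And>x. x \<in> range (\<lambda>i. (q - p) $ i) \<Longrightarrow> real m * x \<in> \<int>"
    by (rule_tac Rats_common_denominator[of "range (\<lambda>i. (q - p) $ i)"]) (auto simp: rational_vec_def)
  have "int_vec (real m *\<^sub>R (q - p))" using m(2) by (auto simp: int_vec_def)
  moreover have "real m *\<^sub>R (q - p) \<noteq> 0" using assms m by simp
  ultimately obtain g :: nat and c \<phi> :: "real ^ 'n" where
    g: "g > 0" "int_vec c" "int_vec \<phi>" "\<phi> \<bullet> c = 1" "real m *\<^sub>R (q - p) = real g *\<^sub>R c"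
    using primitive_multiple by blast
  define k where "k = real g / real m"
  have k: "k > 0" using g m by (simp add: k_def)
  have qp: "q - p = k *\<^sub>R c"
  proof -
    have "q - p = (1 / real m) *\<^sub>R (real m *\<^sub>R (q - p))" using m by simp
    also have "\<dots> = k *\<^sub>R c" unfolding g(5) by (simp add: k_def)
    finally show ?thesis .
  qed
  have p: "p = z + (- r * k) *\<^sub>R c" using assms(5) qp by simp
  have q: "q = z + (k - r * k) *\<^sub>R c" using p qp by (simp add: algebra_simps)
  have "\<phi> \<bullet> (p - z) = - r * k" "\<phi> \<bullet> (q - z) = k - r * k"
    using p q g(4) by auto
  moreover have "\<phi> \<bullet> (p - z) \<in> \<rat>" "\<phi> \<bullet> (q - z) \<in> \<rat>"
    using assms(1,2,4) g(3) by (simp_all add: rational_vec_inner rational_vec_diff int_vec_imp_rational_vec)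
  ultimately show ?thesis using that[of c \<phi> "- r * k" "k - r * k"] g p q k by simp
qed

lemma is_edge_mono: "is_edge P e \<Longrightarrow> P \<subseteq> Q \<Longrightarrow> is_edge Q e"
  unfolding is_edge_def by blast

lemma coherent_sym: "coherent e e' \<Longrightarrow> coherent e' e"
  unfolding coherent_def by (metis Int_iff)

text \<open>The coordinates of a common point on two lines with integer origins and primitive directions are
  integer affine functions of each other; adding multiples of the denominator to the slope makes it
  positive, so that descending along one line can be continued along the other.\<close>
lemma transition:
  fixes z c \<phi> z' c' \<phi>' :: "real ^ 'n"
  assumes "int_vec z" "int_vec z'" "int_vec c'" "int_vec \<phi>'" "int_vec c" "\<phi>' \<bullet> c' = 1"
    and "z + a *\<^sub>R c = z' + t *\<^sub>R c'" "a \<in> \<rat>"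
  obtains k b where "k \<in> \<int>" "k > 0" "b \<in> \<int>" "k * a + b = t"
proof -
  obtain m :: nat where m: "m > 0" "\<And>x. x \<in> {a} \<Longrightarrow> real m * x \<in> \<int>"
    using Rats_common_denominator[of "{a}"] assms(8) by auto
  have "t = \<phi>' \<bullet> (t *\<^sub>R c')" using assms(6) by simp
  also have "t *\<^sub>R c' = a *\<^sub>R c + (z - z')" using assms(7) by (simp add: algebra_simps)
  finally have t: "t = (\<phi>' \<bullet> c) * a + \<phi>' \<bullet> (z - z')" by (simp add: inner_add_right)
  have ints: "\<phi>' \<bullet> c \<in> \<int>" "\<phi>' \<bullet> (z - z') \<in> \<int>"
    using assms by (auto intro!: int_vec_inner int_vec_diff)
  \<comment> \<open>An integer above the absolute value of \<phi>' . c. Adding \<open>m * N\<close>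
    to the slope makes it positive, and the constant term pays back the integer
    \<open>(m * a) * N\<close>.\<close>
  define N where "N = real (nat (\<lceil>\<bar>\<phi>' \<bullet> c\<bar>\<rceil> + 1))"
  have N: "N \<in> \<int>" "N > \<bar>\<phi>' \<bullet> c\<bar>" unfolding N_def by (auto, linarith)
  show ?thesis
  proof (rule that[of "\<phi>' \<bullet> c + real m * N" "\<phi>' \<bullet> (z - z') - (real m * a) * N"])
    have "N \<le> real m * N" using mult_right_mono[of 1 "real m" N] m(1) N(2) by linarith
    then show "\<phi>' \<bullet> c + real m * N > 0" using N by linarith
    show "\<phi>' \<bullet> c + real m * N \<in> \<int>" using ints N by auto
    have "real m * a \<in> \<int>" using m(2) by simp
    then have "(real m * a) * N \<in> \<int>" using N(1) by (rule Ints_mult)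
    then show "\<phi>' \<bullet> (z - z') - (real m * a) * N \<in> \<int>" using ints(2) by (intro Ints_diff)
    show "(\<phi>' \<bullet> c + real m * N) * a + (\<phi>' \<bullet> (z - z') - real m * a * N) = t"
      unfolding t by (simp add: algebra_simps)
  qed
qed

text \<open>The new segment descends to \<open>p\<close> and goes on along an old segment
  \<open>e\<close> through \<open>p\<close>, by the integral substitution of coordinates at
  \<open>p\<close>. Its height is the height on \<open>e\<close> composed with this substitution, so
  the slopes multiply and the old edges stay as they are. Coherence with every old edge through
  \<open>p\<close> is inherited from \<open>e\<close>, since the tree is met only in
  \<open>p\<close>.\<close>

lemma int_tree_attach:
  assumes T: "int_tree P F" and "p \<in> P" "rational_vec p" "rational_vec q" "p \<noteq> q"
    and meet: "closed_segment p q \<inter> P = {p}"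
    and "int_vec z" "z = p + r *\<^sub>R (q - p)"
  shows "\<exists>F'. int_tree (P \<union> closed_segment p q) F'"
proof -
  have F: "finite F" "F \<noteq> {}" "P = (\<Union>e\<in>F. seg e)" "\<And>e. e \<in> F \<Longrightarrow> is_edge P e"
    "\<And>e e'. e \<in> F \<Longrightarrow> e' \<in> F \<Longrightarrow> e \<noteq> e' \<Longrightarrow> coherent e e'"
    using T unfolding int_tree_def by auto
  obtain c \<phi> a b where c: "int_vec c" "int_vec \<phi>" "\<phi> \<bullet> c = 1" "a \<in> \<rat>" "b \<in> \<rat>" "a < b"
    "p = z + a *\<^sub>R c" "q = z + b *\<^sub>R c"
    using int_line_parametrization[OF assms(3,4,5,7,8)] by blast
  obtain e where e: "e \<in> F" "p \<in> seg e" using F(3) \<open>p \<in> P\<close> by blast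
  have ee: "is_edge P e" by (rule F(4)[OF e(1)])
  have ei: "int_vec (origin e)" "int_vec (direction e)" "int_vec (functional e)"
    "functional e \<bullet> direction e = 1" "slope e \<in> \<int>" "0 < slope e" "shift e \<in> \<int>"
    using ee unfolding is_edge_def by auto
  define t where "t = coord e p"
  have t: "low e \<le> t" "t \<le> high e" "origin e + t *\<^sub>R direction e = p"
    using seg_coord[OF ee e(2)] by (simp_all add: t_def)
  obtain k l where k: "k \<in> \<int>" "k > 0" "l \<in> \<int>" "k * a + l = t"
    using transition[OF assms(7) ei(1,2,3) c(1) ei(4)] t(3) c(4,7) by metis
  define g where "g \<theta> = (if \<theta> \<le> a then descent e (k * \<theta> + l) else z + \<theta> *\<^sub>R c)" for \<theta>
  define n where "n = \<lparr>origin = z, direction = c, functional = \<phi>, low = a, high = b,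
    slope = slope e * k, shift = slope e * l + shift e, descent = g\<rparr>"
  have n [simp]: "origin n = z" "direction n = c" "functional n = \<phi>" "low n = a" "high n = b"
    "slope n = slope e * k" "shift n = slope e * l + shift e" "descent n = g"
    by (simp_all add: n_def)
  have height_n: "height n \<theta> = height e (k * \<theta> + l)" for \<theta>
    by (simp add: height_def algebra_simps)
  have down: "k * \<theta> + l \<le> t" if "\<theta> \<le> a" for \<theta>
    using that k by (metis add_right_mono mult_left_mono less_imp_le)
  have desc_t: "descent e t = p"
    using descent_coord[OF ee e(2)] by (simp add: t_def)
  have ga: "g a = z + a *\<^sub>R c" using desc_t k c(7) by (simp add: g_def)
  have seg_n: "seg n = closed_segment p q"
  proof -
    have "z + \<theta> *\<^sub>R c \<in> closed_segment p q" if "\<theta> \<in> {a..b}" for \<theta>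
    proof -
      define u where "u = (\<theta> - a) / (b - a)"
      have "u * (b - a) = \<theta> - a" using c(6) by (simp add: u_def)
      then have u: "\<theta> = (1 - u) * a + u * b" by (simp add: algebra_simps)
      have u01: "0 \<le> u" "u \<le> 1" using that c(6) by (auto simp: u_def)
      have "z + \<theta> *\<^sub>R c = (1 - u) *\<^sub>R p + u *\<^sub>R q" unfolding c(7,8) u by (simp add: algebra_simps)
      then show ?thesis using u01 by (auto simp: closed_segment_def)
    qed
    moreover have "x \<in> (\<lambda>\<theta>. z + \<theta> *\<^sub>R c) ` {a..b}" if "x \<in> closed_segment p q" for x
    proof -
      obtain u where u: "0 \<le> u" "u \<le> 1" "x = (1 - u) *\<^sub>R p + u *\<^sub>R q"
        using \<open>x \<in> closed_segment p q\<close> by (auto simp: closed_segment_def)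
      have "x = z + ((1 - u) * a + u * b) *\<^sub>R c" unfolding u(3) c(7,8) by (simp add: algebra_simps)
      moreover have "(1 - u) * a + u * b \<in> {a..b}"
        using u c(6) convex_bound_le[of a b b "1 - u" u] convex_bound_le[of "-a" "-a" "-b" "1 - u" u] by simp
      ultimately show ?thesis by blast
    qed
    ultimately show ?thesis unfolding seg_def by auto
  qed
  let ?Q = "P \<union> closed_segment p q"
  have height_a: "height n a = height e t" using height_n k by simp
  have n_edge: "is_edge ?Q n"
    unfolding is_edge_def
  proof (intro conjI)
    show "int_vec (origin n)" "int_vec (direction n)" "int_vec (functional n)"
      "functional n \<bullet> direction n = 1" "low n \<in> \<rat>" "high n \<in> \<rat>" "low n \<le> high n"
      using c \<open>int_vec z\<close> by auto
    show "slope n \<in> \<int>" "0 < slope n" "shift n \<in> \<int>" using ei k by auto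
    show "0 \<le> height n (low n)" using height_a height_nonneg[OF ee e(2)] by (simp add: t_def)
    have "continuous_on ({..a} \<union> {a..b}) g"
      unfolding g_def
    proof (rule continuous_on_cases)
      have "continuous_on {..high e} (descent e)" using ee by (simp add: is_edge_def)
      then show "continuous_on {..a} (\<lambda>\<theta>. descent e (k * \<theta> + l))"
      proof (rule continuous_on_compose2)
        show "(\<lambda>\<theta>. k * \<theta> + l) ` {..a} \<subseteq> {..high e}" using down t(2) order_trans by blast
      qed (intro continuous_intros)
      show "continuous_on {a..b} (\<lambda>\<theta>. z + \<theta> *\<^sub>R c)" by (intro continuous_intros)
      show "\<forall>x. x \<in> {..a} \<and> \<not> x \<le> a \<or> x \<in> {a..b} \<and> x \<le> a \<longrightarrow> descent e (k * x + l) = z + x *\<^sub>R c"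
        using ga by (auto simp: g_def)
    qed auto
    moreover have "{..a} \<union> {a..b} = {..b}" using c(6) by auto
    ultimately show "continuous_on {..high n} (descent n)" by simp
    have "descent e (k * \<theta> + l) \<in> P" if "\<theta> \<le> a" for \<theta>
      using ee down[OF that] t(2) unfolding is_edge_def by auto
    moreover have "z + \<theta> *\<^sub>R c \<in> closed_segment p q" if "\<theta> \<in> {a..b}" for \<theta>
    proof -
      have "z + \<theta> *\<^sub>R c \<in> seg n" using that by (auto simp: seg_def)
      then show ?thesis by (simp add: seg_n)
    qed
    ultimately show "descent n ` {..high n} \<subseteq> ?Q" by (auto simp: g_def)
    show "\<forall>\<theta>\<in>{low n..high n}. descent n \<theta> = origin n + \<theta> *\<^sub>R direction n"
      using ga by (auto simp: g_def)
    show "\<forall>\<theta>\<le>high n. height n \<theta> \<le> 0 \<longrightarrow> descent n \<theta> = 1"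
    proof (intro allI impI)
      fix \<theta> assume \<theta>: "\<theta> \<le> high n" "height n \<theta> \<le> 0"
      have "\<theta> \<le> a"
      proof (rule ccontr)
        assume "\<not> \<theta> \<le> a"
        then have "height n a < height n \<theta>" using ei k by (simp add: height_def)
        then show False using \<theta> height_a height_nonneg[OF ee e(2)] by (simp add: t_def)
      qed
      then show "descent n \<theta> = 1"
        using ee down[of \<theta>] t(2) \<theta>(2) unfolding is_edge_def height_n by (auto simp: g_def)
    qed
    obtain K where K: "finite K" "K \<subseteq> \<int> \<times> \<int>" "\<forall>\<theta>\<le>high e. \<forall>j. \<exists>(a, b)\<in>K. descent e \<theta> $ j = a * \<theta> + b"
      using ee unfolding is_edge_def by blast
    \<comment> \<open>The pieces of \<open>e\<close> precomposed with
      \<open>k * \<theta> + l\<close>, together with those of the straight part on the new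
      segment.\<close>
    let ?K = "(\<lambda>(a, b). (a * k, a * l + b)) ` K \<union> range (\<lambda>j. (c $ j, z $ j))"
    show "\<exists>K. finite K \<and> K \<subseteq> \<int> \<times> \<int> \<and> (\<forall>\<theta>\<le>high n. \<forall>j. \<exists>(a, b)\<in>K. descent n \<theta> $ j = a * \<theta> + b)"
    proof (intro exI[of _ ?K] conjI allI impI)
      show "?K \<subseteq> \<int> \<times> \<int>" using K(2) k c(1) \<open>int_vec z\<close> by (auto simp: int_vec_def)
      fix \<theta> j assume "\<theta> \<le> high n"
      show "\<exists>(a, b)\<in>?K. descent n \<theta> $ j = a * \<theta> + b"
      proof (cases "\<theta> \<le> a")
        case True
        have "k * \<theta> + l \<le> high e" using down[OF True] t(2) by linarith
        then obtain a' b' where ab: "(a', b') \<in> K" "descent e (k * \<theta> + l) $ j = a' * (k * \<theta> + l) + b'"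
          using K(3) by blast
        have "(a' * k, a' * l + b') \<in> ?K" using imageI[OF ab(1), of "\<lambda>(a, b). (a * k, a * l + b)"] by simp
        then show ?thesis
          by (rule bexI[rotated]) (use True ab(2) in \<open>simp add: g_def algebra_simps\<close>)
      next
        case False
        then show ?thesis
          by (intro bexI[of _ "(c $ j, z $ j)"]) (auto simp: g_def algebra_simps)
      qed
    qed (use K in auto)
  qed
  have pt_n: "point_at n h = point_at e h" if "h \<le> height e t" for h
  proof -
    define \<theta> where "\<theta> = (h - shift n) / slope n"
    have h: "height n \<theta> = h" unfolding \<theta>_def by (rule height_inverse[OF n_edge])
    have "\<theta> \<le> a"
    proof (rule ccontr)
      assume "\<not> \<theta> \<le> a"
      then have "height n a < height n \<theta>" using ei k by (simp add: height_def)
      then show False using that h height_a by simp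
    qed
    then have "descent n \<theta> = descent e (k * \<theta> + l)" by (simp add: g_def)
    also have "\<dots> = point_at e (height e (k * \<theta> + l))" by (rule point_at_height[OF ee, symmetric])
    also have "height e (k * \<theta> + l) = h" using h height_n by simp
    finally show ?thesis by (simp add: point_at_def \<theta>_def)
  qed
  have coh_n: "coherent n e'" if e': "e' \<in> F" for e'
  proof -
    have only: "x = p" if "x \<in> seg n \<inter> seg e'" for x
      using that meet seg_n F(3) e' by blast
    have "height n (coord n p) = height e' (coord e' p) \<and>
       (\<forall>h \<le> height n (coord n p). point_at n h = point_at e' h)" if p': "p \<in> seg e'"
    proof -
      have cp: "coord n p = a" using coord_origin[OF n_edge, of a] c(7) by simp
      have "height e (coord e p) = height e' (coord e' p) \<and>
        (\<forall>h \<le> height e (coord e p). point_at e h = point_at e' h)"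
      proof (cases "e = e'")
        case False
        then show ?thesis using F(5)[OF e(1) e' False] e(2) p' unfolding coherent_def by blast
      qed auto
      then show ?thesis using height_a cp pt_n unfolding t_def[symmetric] by auto
    qed
    then show ?thesis unfolding coherent_def using only by blast
  qed
  have "int_tree ?Q (insert n F)"
    unfolding int_tree_def
  proof (intro conjI ballI impI)
    fix e' e'' assume "e' \<in> insert n F" "e'' \<in> insert n F" "e' \<noteq> e''"
    then show "coherent e' e''" using F(5) coh_n coherent_sym by blast
  next
    fix e' assume "e' \<in> insert n F"
    then show "is_edge ?Q e'" using n_edge is_edge_mono[OF F(4)] by blast
  qed (use F seg_n in auto)
  then show ?thesis by blast
qed

section \<open>One-dimensional rational polyhedra as graphs\<close>

text \<open>The reals are a vector space over the rationals, and 1 is independent, so a linear map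
  to the rationals may be prescribed to be 1 there. Applied coordinatewise, it turns a real solution
  of linear equations with rational coefficients into a rational one.\<close>

lemma rational_projection:
  obtains \<pi> :: "real \<Rightarrow> real"
  where "\<And>x y. \<pi> (x + y) = \<pi> x + \<pi> y" "\<And>q x. q \<in> \<rat> \<Longrightarrow> \<pi> (q * x) = q * \<pi> x"
    "\<pi> 1 = 1" "\<And>x. \<pi> x \<in> \<rat>"
proof -
  interpret V: vector_space_pair "\<lambda>(q::rat) (x::real). of_rat q * x" "\<lambda>(q::rat) x. q * x"
    by unfold_locales (auto simp: algebra_simps of_rat_add of_rat_mult)
  have "V.vs1.independent {1}" by (simp add: V.vs1.independent_insert)
  then obtain g where g: "Vector_Spaces.linear (\<lambda>(q::rat) (x::real). of_rat q * x) (\<lambda>(q::rat) x. q * x) g" "g 1 = 1"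
    using V.linear_independent_extend[of "{1}" "\<lambda>_. 1"] by auto
  interpret g: Vector_Spaces.linear "\<lambda>(q::rat) (x::real). of_rat q * x" "\<lambda>(q::rat) x. q * x" g
    by (rule g(1))
  show ?thesis
  proof (rule that[of "\<lambda>x. of_rat (g x)"])
    show "of_rat (g (x + y)) = (of_rat (g x) + of_rat (g y) :: real)" for x y
      by (simp add: g.add of_rat_add)
    show "of_rat (g (q * x)) = q * (of_rat (g x) :: real)" if "q \<in> \<rat>" for q x
    proof -
      obtain r where "q = of_rat r" using \<open>q \<in> \<rat>\<close> unfolding Rats_def by blast
      then show ?thesis using g.scale[of r x] by (simp add: of_rat_mult)
    qed
  qed (auto simp: g(2))
qed

text \<open>If \<open>x\<close> were irrational, its projection \<open>px\<close> would be a
  different point on both lines, because the projection respects their rational equations. An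
  irrational point is inner to both segments, so a small step from \<open>x\<close> towards
  \<open>px\<close> would stay in both, against the uniqueness of the common point.\<close>

lemma rational_segments_Int:
  fixes a b a' b' :: "real ^ 'n"
  assumes rat: "rational_vec a" "rational_vec b" "rational_vec a'" "rational_vec b'"
    and single: "closed_segment a b \<inter> closed_segment a' b' = {x}"
  shows "rational_vec x"
proof (rule ccontr)
  assume irr: "\<not> rational_vec x"
  obtain \<pi> :: "real \<Rightarrow> real" where \<pi>: "\<And>x y. \<pi> (x + y) = \<pi> x + \<pi> y"
    "\<And>q x. q \<in> \<rat> \<Longrightarrow> \<pi> (q * x) = q * \<pi> x" "\<pi> 1 = 1" "\<And>x. \<pi> x \<in> \<rat>"
    using rational_projection by blast
  have \<pi>q: "\<pi> q = q" if "q \<in> \<rat>" for q using \<pi>(2)[OF that, of 1] \<pi>(3) by simp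
  define px where "px = (\<chi> i. \<pi> (x $ i))"
  have px: "px = p + \<pi> s *\<^sub>R (q - p)"
    if "rational_vec p" "rational_vec q" "x = p + s *\<^sub>R (q - p)" for p q s
  proof -
    have "px $ i = (p + \<pi> s *\<^sub>R (q - p)) $ i" for i
    proof -
      have r: "p $ i \<in> \<rat>" "(q - p) $ i \<in> \<rat>" using that by (auto simp: rational_vec_def)
      have "px $ i = \<pi> (p $ i + (q - p) $ i * s)" using that(3) by (simp add: px_def mult.commute)
      also have "\<dots> = p $ i + (q - p) $ i * \<pi> s" using r \<pi>(1) \<pi>(2)[OF r(2)] \<pi>q[OF r(1)] by simp
      finally show ?thesis by (simp add: mult.commute)
    qed
    then show ?thesis by (simp add: vec_eq_iff)
  qed
  have "rational_vec px" using \<pi>(4) by (simp add: rational_vec_def px_def)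
  then have "px \<noteq> x" using irr by blast
  have small: "\<forall>\<^sub>F \<epsilon> in at_right 0. x + \<epsilon> *\<^sub>R (px - x) \<in> closed_segment p q"
    if pq: "rational_vec p" "rational_vec q" "x \<in> closed_segment p q" for p q
  proof -
    obtain s where s: "0 \<le> s" "s \<le> 1" "x = (1 - s) *\<^sub>R p + s *\<^sub>R q"
      using pq(3) by (auto simp: closed_segment_def)
    have xs: "x = p + s *\<^sub>R (q - p)" using s(3) by (simp add: algebra_simps)
    have "s \<noteq> 0" "s \<noteq> 1" using s(3) pq irr by auto
    then have s01: "0 < s" "s < 1" using s by auto
    have "((\<lambda>\<epsilon>. s + \<epsilon> * (\<pi> s - s)) \<longlongrightarrow> s + 0 * (\<pi> s - s)) (at_right 0)"
      by (intro tendsto_intros)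
    then have "\<forall>\<^sub>F \<epsilon> in at_right 0. 0 < s + \<epsilon> * (\<pi> s - s) \<and> s + \<epsilon> * (\<pi> s - s) < 1"
      using s01 by (intro eventually_conj order_tendstoD) auto
    then show ?thesis
    proof eventually_elim
      case (elim \<epsilon>)
      let ?t = "s + \<epsilon> * (\<pi> s - s)"
      have "x + \<epsilon> *\<^sub>R (px - x) = (1 - ?t) *\<^sub>R p + ?t *\<^sub>R q"
        unfolding px[OF pq(1,2) xs] by (subst (1 2) xs) (simp add: algebra_simps)
      then show ?case using elim by (auto simp: closed_segment_def intro!: exI[of _ ?t])
    qed
  qed
  have xin: "x \<in> closed_segment a b" "x \<in> closed_segment a' b'" using single by blast+
  have "\<forall>\<^sub>F \<epsilon> in at_right 0. x + \<epsilon> *\<^sub>R (px - x) \<in> closed_segment a b \<and>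
      x + \<epsilon> *\<^sub>R (px - x) \<in> closed_segment a' b' \<and> \<epsilon> > 0"
    by (intro eventually_conj small rat xin eventually_at_right_less)
  then obtain \<epsilon> where "x + \<epsilon> *\<^sub>R (px - x) \<in> closed_segment a b \<inter> closed_segment a' b'" "\<epsilon> > (0::real)"
    using eventually_happens'[OF trivial_limit_at_right_real] by blast
  then have "x + \<epsilon> *\<^sub>R (px - x) = x" "\<epsilon> > 0" unfolding single by auto
  then show False using \<open>px \<noteq> x\<close> by simp
qed

text \<open>A compact collinear convex set is a segment, and its ends are extreme points of the
  hull, hence among the generators.\<close>

lemma rational_convex_hull_segment:
  assumes "finite V" "V \<noteq> {}" "aff_dim V \<le> 1"
  obtains a b where "a \<in> V" "b \<in> V" "convex hull V = closed_segment a b"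
proof -
  have "collinear (convex hull V)" using assms(3) by (simp add: collinear_aff_dim aff_dim_convex_hull)
  then obtain a b where ab: "convex hull V = closed_segment a b"
    using compact_convex_collinear_segment[of "convex hull V"] assms(1,2)
    by (metis compact_convex_hull convex_convex_hull convex_hull_eq_empty finite_imp_compact)
  have "a \<in> V" "b \<in> V"
    by (rule extreme_point_of_convex_hull, simp add: ab extreme_point_of_segment)+
  then show ?thesis using that ab by blast
qed

lemma polyhedron_dim_ge:
  fixes V :: "(real ^ 'n) set"
  assumes "convex hull V \<subseteq> P"
  shows "aff_dim V \<le> polyhedron_dim P"
proof -
  obtain B where B: "\<not> affine_dependent B" "B \<subseteq> V" "affine hull B = affine hull V"
    using affine_basis_exists by metis
  have "aff_dim V = aff_dim B" using B(3) by (metis aff_dim_affine_hull)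
  also have "\<dots> = int (card B) - 1" using B(1) by (simp add: aff_dim_affine_independent)
  finally have "aff_dim V simplex (convex hull B)" using B(1) by (auto simp: simplex_def)
  moreover have "convex hull B \<subseteq> P" using B(2) assms hull_mono by blast
  \<comment> \<open>\<open>Max\<close> says nothing about infinite sets, so the possible dimensions
    are bounded by those of the empty set and of the whole space.\<close>
  moreover have "finite {k. \<exists>S. k simplex S \<and> S \<subseteq> P}"
  proof (rule finite_subset)
    show "{k. \<exists>S. k simplex S \<and> S \<subseteq> P} \<subseteq> {-1..int DIM(real ^ 'n)}"
    proof safe
      fix k and S :: "(real ^ 'n) set" assume "k simplex S"
      then have "k = aff_dim S" by (simp add: aff_dim_simplex)
      then show "k \<in> {-1..int DIM(real ^ 'n)}" using aff_dim_le_DIM[of S] aff_dim_geq[of S] by simp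
    qed
  qed simp
  ultimately show ?thesis unfolding polyhedron_dim_def by (intro Max_ge) blast+
qed

lemma one_dim_polyhedron_segments:
  fixes P :: "(real ^ 'n) set"
  assumes "rational_polyhedron P" "polyhedron_dim P \<le> 1"
  obtains S where "finite S" "\<And>a b. (a, b) \<in> S \<Longrightarrow> rational_vec a \<and> rational_vec b"
    "P = (\<Union>(a, b)\<in>S. closed_segment a b)"
proof -
  obtain \<V> where V: "finite \<V>" "\<And>V. V \<in> \<V> \<Longrightarrow> finite V" "\<And>V v. V \<in> \<V> \<Longrightarrow> v \<in> V \<Longrightarrow> rational_vec v"
    "P = (\<Union>V\<in>\<V>. convex hull V)"
    using assms(1) unfolding rational_polyhedron_def by blast
  have "\<exists>s. fst s \<in> V \<and> snd s \<in> V \<and> convex hull V = closed_segment (fst s) (snd s)" if "V \<in> \<V> - {{}}" for V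
  proof -
    have "aff_dim V \<le> 1" using polyhedron_dim_ge[of V P] V(4) that assms(2) by fastforce
    then show ?thesis using rational_convex_hull_segment[of V] V(2) that
      by (metis DiffE fst_conv singletonI snd_conv)
  qed
  then obtain s where s: "\<And>V. V \<in> \<V> - {{}} \<Longrightarrow> fst (s V) \<in> V \<and> snd (s V) \<in> V \<and>
      convex hull V = closed_segment (fst (s V)) (snd (s V))"
    by metis
  show ?thesis
  proof (rule that[of "s ` (\<V> - {{}})"])
    show "finite (s ` (\<V> - {{}}))" using V(1) by simp
    show "rational_vec a \<and> rational_vec b" if "(a, b) \<in> s ` (\<V> - {{}})" for a b
    proof -
      obtain V where "V \<in> \<V> - {{}}" "s V = (a, b)" using \<open>(a, b) \<in> s ` (\<V> - {{}})\<close> by force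
      then have "V \<in> \<V>" "a \<in> V" "b \<in> V" using s[of V] by auto
      then show ?thesis using V(3) by blast
    qed
    have "P = (\<Union>V\<in>\<V> - {{}}. convex hull V)" using V(4) by auto
    also have "\<dots> = (\<Union>(a, b)\<in>s ` (\<V> - {{}}). closed_segment a b)"
      using s by (simp add: case_prod_beta)
    finally show "P = (\<Union>(a, b)\<in>s ` (\<V> - {{}}). closed_segment a b)" .
  qed
qed

section \<open>Continuous logarithms rule out cycles\<close>

lemma exp_eq_1_constant_on:
  fixes f :: "'a :: topological_space \<Rightarrow> complex"
  assumes "connected S" "continuous_on S f" "\<And>x. x \<in> S \<Longrightarrow> exp (f x) = 1" "x \<in> S" "y \<in> S"
  shows "f x = f y"
proof -
  have "f constant_on S"
  proof (rule continuous_discrete_range_constant[OF assms(1,2)])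
    fix x assume x: "x \<in> S"
    \<comment> \<open>Logarithms of 1 are the integer multiples of 2 pi i, so distinct values of
      \<open>f\<close> are at least 2 pi apart.\<close>
    have "2 * pi \<le> norm (f y - f x)" if y: "y \<in> S \<and> f y \<noteq> f x" for y
    proof -
      have "exp (f x) = 1" "exp (f y) = 1" using assms(3) x y by auto
      then obtain m n :: int where mn: "Re (f x) = 0" "Im (f x) = of_int (2 * m) * pi"
        "Re (f y) = 0" "Im (f y) = of_int (2 * n) * pi"
        unfolding exp_eq_1 by blast
      have "f y - f x = of_real (of_int (n - m) * (2 * pi)) * \<i>"
        using mn by (intro complex_eqI) (auto simp: algebra_simps)
      then have "norm (f y - f x) = \<bar>of_int (n - m) * (2 * pi)\<bar>"
        by (simp only: norm_mult norm_of_real norm_ii mult_1_right)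
      then have eq: "norm (f y - f x) = \<bar>of_int (n - m)\<bar> * (2 * pi)"
        by (simp only: abs_mult) simp
      have "n \<noteq> m" using mn y by (auto simp: complex_eq_iff)
      then have "1 \<le> \<bar>n - m\<bar>" by linarith
      then have "1 \<le> \<bar>of_int (n - m) :: real\<bar>" by linarith
      then show ?thesis using mult_right_mono[of 1 "\<bar>of_int (n - m)\<bar>" "2 * pi"] unfolding eq by simp
    qed
    then show "\<exists>e>0. \<forall>y. y \<in> S \<and> f y \<noteq> f x \<longrightarrow> e \<le> norm (f y - f x)"
      using pi_gt_zero by (intro exI[of _ "2 * pi"]) auto
  qed
  then show ?thesis using assms(4,5) unfolding constant_on_def by auto
qed

text \<open>Otherwise wrapping the open segment once around the unit circle and collapsing \<open>C\<close> to a point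
  is a map without continuous logarithm.\<close>
lemma contractible_no_cycle:
  fixes u w :: "'a :: euclidean_space"
  assumes "contractible P" "closed C" "P = C \<union> open_segment u w" "C \<inter> open_segment u w = {}"
    and "u \<noteq> w" "connected T" "T \<subseteq> C" "u \<in> T" "w \<in> T"
  shows False
proof -
  \<comment> \<open>The affine parameter of the segment, extended to the whole space by orthogonal
    projection onto its line.\<close>
  define \<sigma> where "\<sigma> x = ((x - u) \<bullet> (w - u)) / ((w - u) \<bullet> (w - u))" for x
  define g where "g x = (if x \<in> C then 1 else exp (of_real (2 * pi * \<sigma> x) * \<i>))" for x
  have ends: "\<sigma> u = 0" "\<sigma> w = 1" using \<open>u \<noteq> w\<close> by (auto simp: \<sigma>_def)
  have cont\<sigma>: "continuous_on A \<sigma>" for A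
    using \<open>u \<noteq> w\<close> unfolding \<sigma>_def by (intro continuous_intros) auto
  have P: "P = C \<union> closed_segment u w"
    using assms(3,7,8,9) by (auto simp: closed_segment_eq_open)
  have g_seg: "g x = exp (of_real (2 * pi * \<sigma> x) * \<i>)" if "x \<in> closed_segment u w" for x
  proof (cases "x \<in> C")
    case True
    then have "x = u \<or> x = w" using that assms(4) by (auto simp: closed_segment_eq_open)
    then have "exp (of_real (2 * pi * \<sigma> x) * \<i>) = 1"
      using ends by (auto simp: exp_eq_1 intro: exI[of _ 1])
    then show ?thesis using True by (simp add: g_def)
  qed (simp add: g_def)
  have "continuous_on (C \<union> closed_segment u w) g"
    unfolding g_def
  proof (rule continuous_on_cases)
    show "continuous_on (closed_segment u w) (\<lambda>x. exp (of_real (2 * pi * \<sigma> x) * \<i>))"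
      by (intro continuous_intros cont\<sigma>)
    show "\<forall>x. x \<in> C \<and> x \<notin> C \<or> x \<in> closed_segment u w \<and> x \<in> C \<longrightarrow> 1 = exp (of_real (2 * pi * \<sigma> x) * \<i>)"
      using g_seg unfolding g_def by metis
  qed (use \<open>closed C\<close> in auto)
  then have "continuous_on P g" by (simp add: P)
  moreover have "g x \<noteq> 0" for x by (simp add: g_def)
  ultimately obtain h where h: "continuous_on P h" "\<And>x. x \<in> P \<Longrightarrow> g x = exp (h x)"
    using continuous_logarithm_on_contractible[of P g] \<open>contractible P\<close> by blast
  have "h u = h w"
  proof (rule exp_eq_1_constant_on[of T])
    show "exp (h x) = 1" if "x \<in> T" for x
      using h(2)[of x] that assms(3,7) by (auto simp: g_def)
    show "continuous_on T h" by (rule continuous_on_subset[OF h(1)]) (use assms(3,7) in auto)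
  qed (use assms in auto)
  \<comment> \<open>On the segment \<open>h\<close> and 2 pi i \<sigma> are logarithms of the same
    function, so \<open>h\<close> gains 2 pi i from \<open>u\<close> to \<open>w\<close>; yet along
    \<open>T\<close>, where \<open>g\<close> is 1, it is constant.\<close>
  moreover have "h u - of_real (2 * pi * \<sigma> u) * \<i> = h w - of_real (2 * pi * \<sigma> w) * \<i>"
  proof (rule exp_eq_1_constant_on[of "closed_segment u w" "\<lambda>x. h x - of_real (2 * pi * \<sigma> x) * \<i>"])
    show "continuous_on (closed_segment u w) (\<lambda>x. h x - of_real (2 * pi * \<sigma> x) * \<i>)"
      by (intro continuous_intros cont\<sigma> continuous_on_subset[OF h(1)]) (use P in auto)
    show "exp (h x - of_real (2 * pi * \<sigma> x) * \<i>) = 1" if "x \<in> closed_segment u w" for x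
      using h(2)[of x] g_seg[OF that] that P by (simp add: exp_diff)
  qed auto
  ultimately show False using ends by (simp add: complex_eq_iff)
qed

section \<open>Subdividing a segment at finitely many points\<close>

lemma closed_segment_line:
  fixes x y z :: "'a :: real_vector"
  assumes "x \<in> closed_segment a b" "y \<in> closed_segment a b" "z \<in> closed_segment a b" "x \<noteq> y"
  obtains t where "z = x + t *\<^sub>R (y - x)"
proof -
  obtain r s t where rst: "x = (1 - r) *\<^sub>R a + r *\<^sub>R b" "y = (1 - s) *\<^sub>R a + s *\<^sub>R b" "z = (1 - t) *\<^sub>R a + t *\<^sub>R b"
    using assms by (auto simp: closed_segment_def)
  have "r \<noteq> s" using rst assms(4) by auto
  have yx: "y - x = (s - r) *\<^sub>R (b - a)" unfolding rst(1,2) by (simp add: algebra_simps)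
  have "z = x + (t - r) *\<^sub>R (b - a)" unfolding rst(1,3) by (simp add: algebra_simps)
  also have "(t - r) *\<^sub>R (b - a) = ((t - r) / (s - r)) *\<^sub>R (y - x)" using \<open>r \<noteq> s\<close> unfolding yx by simp
  finally show ?thesis using that by blast
qed

lemma in_open_segment_line:
  fixes x d :: "'a :: real_vector"
  assumes "\<alpha> < \<tau>" "\<tau> < \<beta>" "d \<noteq> 0"
  shows "x + \<tau> *\<^sub>R d \<in> open_segment (x + \<alpha> *\<^sub>R d) (x + \<beta> *\<^sub>R d)"
proof -
  define v where "v = (\<tau> - \<alpha>) / (\<beta> - \<alpha>)"
  have v: "0 < v" "v < 1" using assms by (auto simp: v_def)
  have "v * (\<beta> - \<alpha>) = \<tau> - \<alpha>" using assms by (simp add: v_def)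
  then have \<tau>: "\<tau> = (1 - v) * \<alpha> + v * \<beta>" by (simp add: algebra_simps)
  have "x + \<tau> *\<^sub>R d = (1 - v) *\<^sub>R (x + \<alpha> *\<^sub>R d) + v *\<^sub>R (x + \<beta> *\<^sub>R d)"
    unfolding \<tau> by (simp add: algebra_simps)
  moreover have "x + \<alpha> *\<^sub>R d \<noteq> x + \<beta> *\<^sub>R d" using assms by auto
  ultimately show ?thesis using v by (auto simp: in_segment)
qed

lemma open_segment_lineE:
  fixes x d :: "'a :: real_vector"
  assumes "x \<in> open_segment (x + \<alpha> *\<^sub>R d) (x + \<beta> *\<^sub>R d)"
  shows "\<alpha> < 0 \<and> 0 < \<beta> \<or> \<beta> < 0 \<and> 0 < \<alpha>"
proof -
  obtain v where v: "0 < v" "v < 1" "x = (1 - v) *\<^sub>R (x + \<alpha> *\<^sub>R d) + v *\<^sub>R (x + \<beta> *\<^sub>R d)"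
    and ne: "x + \<alpha> *\<^sub>R d \<noteq> x + \<beta> *\<^sub>R d"
    using assms by (auto simp: in_segment)
  then have "((1 - v) * \<alpha> + v * \<beta>) *\<^sub>R d = 0" by (simp add: algebra_simps)
  moreover have "d \<noteq> 0" "\<alpha> \<noteq> \<beta>" using ne by auto
  ultimately have eq: "(1 - v) * \<alpha> + v * \<beta> = 0" by simp
  then have "\<alpha> = v * (\<alpha> - \<beta>)" "\<beta> = (1 - v) * (\<beta> - \<alpha>)" by (simp_all add: algebra_simps)
  then show ?thesis using v \<open>\<alpha> \<noteq> \<beta>\<close>
    by (metis diff_gt_0_iff_gt linorder_neqE_linordered_idom mult_pos_neg mult_pos_pos diff_less_0_iff_less)
qed

text \<open>Both segments lie on one line through \<open>x\<close>, and on each side of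
  \<open>x\<close> their end is the nearest point of \<open>W\<close> on that line, which determines
  them up to orientation.\<close>

lemma elementary_segments_eq:
  fixes u w u' w' x :: "'a :: euclidean_space"
  assumes W: "u \<in> W" "w \<in> W" "u' \<in> W" "w' \<in> W" "open_segment u w \<inter> W = {}" "open_segment u' w' \<inter> W = {}"
    and x: "x \<in> open_segment u w" "x \<in> closed_segment u' w'"
    and line: "u = x + \<alpha> *\<^sub>R d" "w = x + \<beta> *\<^sub>R d" "u' = x + \<alpha>' *\<^sub>R d" "w' = x + \<beta>' *\<^sub>R d"
  shows "{u, w} = {u', w'}"
proof -
  have x': "x \<in> open_segment u' w'"
    using x W by (auto simp: closed_segment_eq_open)
  have d: "d \<noteq> 0" using x(1) line by auto
  \<comment> \<open>With the parameters normalized to \<open>a < 0 < b\<close>, the possible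
    orientations of both segments are treated at once.\<close>
  have core: "{u, w} = {u', w'}"
    if "a < 0" "0 < b" "a' < 0" "0 < b'" "{x + a *\<^sub>R d, x + b *\<^sub>R d} = {u, w}" "{x + a' *\<^sub>R d, x + b' *\<^sub>R d} = {u', w'}"
    for a b a' b'
  proof -
    have os: "open_segment (x + a *\<^sub>R d) (x + b *\<^sub>R d) = open_segment u w"
      "open_segment (x + a' *\<^sub>R d) (x + b' *\<^sub>R d) = open_segment u' w'"
      using that(5,6) by (metis doubleton_eq_iff open_segment_commute)+
    have inW: "x + a *\<^sub>R d \<in> W" "x + b *\<^sub>R d \<in> W" "x + a' *\<^sub>R d \<in> W" "x + b' *\<^sub>R d \<in> W"
    proof -
      have "{u, w} \<subseteq> W" "{u', w'} \<subseteq> W" using W by auto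
      then show "x + a *\<^sub>R d \<in> W" "x + b *\<^sub>R d \<in> W" "x + a' *\<^sub>R d \<in> W" "x + b' *\<^sub>R d \<in> W"
        unfolding that(5,6)[symmetric] by auto
    qed
    have no: "\<not> (a < t \<and> t < b)" if "x + t *\<^sub>R d \<in> W" for t
      using in_open_segment_line[OF _ _ d, of a t b x] that W(5) os by blast
    have no': "\<not> (a' < t \<and> t < b')" if "x + t *\<^sub>R d \<in> W" for t
      using in_open_segment_line[OF _ _ d, of a' t b' x] that W(6) os by blast
    have "a = a'" "b = b'"
      using no[OF inW(3)] no[OF inW(4)] no'[OF inW(1)] no'[OF inW(2)] that(1-4) by linarith+
    then show ?thesis using that(5,6) by simp
  qed
  have "\<alpha> < 0 \<and> 0 < \<beta> \<or> \<beta> < 0 \<and> 0 < \<alpha>" "\<alpha>' < 0 \<and> 0 < \<beta>' \<or> \<beta>' < 0 \<and> 0 < \<alpha>'"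
    using open_segment_lineE x(1) x' line by metis+
  moreover have "{x + \<alpha> *\<^sub>R d, x + \<beta> *\<^sub>R d} = {u, w}" "{x + \<beta> *\<^sub>R d, x + \<alpha> *\<^sub>R d} = {u, w}"
    "{x + \<alpha>' *\<^sub>R d, x + \<beta>' *\<^sub>R d} = {u', w'}" "{x + \<beta>' *\<^sub>R d, x + \<alpha>' *\<^sub>R d} = {u', w'}"
    unfolding line by blast+
  ultimately show ?thesis using core by meson
qed

text \<open>\<open>u\<close> and \<open>w\<close> are the neighbours of \<open>x\<close> among the
  finitely many points of \<open>W\<close> on the segment; they exist because the ends
  \<open>a\<close> and \<open>b\<close> belong to \<open>W\<close>.\<close>

lemma segment_subdivision:
  fixes a b x :: "'a :: euclidean_space"
  assumes "finite W" "a \<in> W" "b \<in> W" "x \<in> closed_segment a b" "x \<notin> W"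
  obtains u w where "u \<in> W" "w \<in> W" "u \<noteq> w" "open_segment u w \<inter> W = {}" "x \<in> closed_segment u w"
    "closed_segment u w \<subseteq> closed_segment a b"
proof -
  have "a \<noteq> b" using assms by auto
  then have d: "b - a \<noteq> 0" by simp
  define \<gamma> where "\<gamma> t = a + t *\<^sub>R (b - a)" for t
  have inj: "inj \<gamma>" using d by (auto simp: \<gamma>_def inj_def)
  have \<gamma>_seg: "\<gamma> t \<in> closed_segment a b" if "0 \<le> t" "t \<le> 1" for t
    using that by (auto simp: \<gamma>_def closed_segment_def algebra_simps intro!: exI[of _ t])
  obtain t where t: "0 \<le> t" "t \<le> 1" "x = \<gamma> t"
    using assms(4) by (auto simp: \<gamma>_def closed_segment_def algebra_simps)
  define T where "T = {s. 0 \<le> s \<and> s \<le> 1 \<and> \<gamma> s \<in> W}"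
  have finT: "finite T"
    using finite_vimageI[OF \<open>finite W\<close> inj] by (rule finite_subset[rotated]) (auto simp: T_def)
  have T01: "0 \<in> T" "1 \<in> T" "t \<notin> T" using assms t by (auto simp: T_def \<gamma>_def)
  have t01: "0 < t" "t < 1" using T01 t by (metis less_eq_real_def)+
  define l where "l = Max {s \<in> T. s < t}"
  define r where "r = Min {s \<in> T. t < s}"
  have "l \<in> {s \<in> T. s < t}" unfolding l_def using finT T01 t01 by (intro Max_in) auto
  then have l: "l \<in> T" "l < t" by auto
  have "r \<in> {s \<in> T. t < s}" unfolding r_def using finT T01 t01 by (intro Min_in) auto
  then have r: "r \<in> T" "t < r" by auto
  have gap: "s \<notin> T" if "l < s" "s < r" for s
  proof
    assume s: "s \<in> T"
    consider "s < t" | "s = t" | "s > t" by linarith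
    then show False
    proof cases
      case 1
      then have "s \<le> l" unfolding l_def using s finT by (intro Max_ge) auto
      then show False using that by simp
    next
      case 3
      then have "r \<le> s" unfolding r_def using s finT by (intro Min_le) auto
      then show False using that by simp
    qed (use s T01 in auto)
  qed
  show ?thesis
  proof (rule that[of "\<gamma> l" "\<gamma> r"])
    show "\<gamma> l \<in> W" "\<gamma> r \<in> W" using l r by (auto simp: T_def)
    show "\<gamma> l \<noteq> \<gamma> r" using injD[OF inj, of l r] l r by auto
    show "x \<in> closed_segment (\<gamma> l) (\<gamma> r)"
      using in_open_segment_line[OF l(2) r(2) d, of a] t(3) open_closed_segment unfolding \<gamma>_def by blast
    have "closed_segment a b \<supseteq> closed_segment (\<gamma> l) (\<gamma> r)"
      using l r by (intro closed_segment_subset \<gamma>_seg) (auto simp: T_def)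
    then show "closed_segment (\<gamma> l) (\<gamma> r) \<subseteq> closed_segment a b" .
    show "open_segment (\<gamma> l) (\<gamma> r) \<inter> W = {}"
    proof (rule ccontr)
      assume "open_segment (\<gamma> l) (\<gamma> r) \<inter> W \<noteq> {}"
      then obtain v where v: "0 < v" "v < 1" "(1 - v) *\<^sub>R \<gamma> l + v *\<^sub>R \<gamma> r \<in> W"
        by (auto simp: in_segment)
      define s where "s = (1 - v) * l + v * r"
      have "(1 - v) *\<^sub>R \<gamma> l + v *\<^sub>R \<gamma> r = \<gamma> s" by (simp add: \<gamma>_def s_def algebra_simps)
      moreover have "s - l = v * (r - l)" "r - s = (1 - v) * (r - l)" by (simp_all add: s_def algebra_simps)
      then have "l < s" "s < r" using v l r by (metis diff_gt_0_iff_gt mult_pos_pos order.strict_trans)+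
      ultimately show False using gap[of s] v l r by (auto simp: T_def)
    qed
  qed
qed

section \<open>Denominators and integer points on lines\<close>

lemma den_rational_vec:
  assumes "rational_vec x"
  shows "den x > 0" "int_vec (real (den x) *\<^sub>R x)"
proof -
  obtain m :: nat where "m > 0" "\<And>y. y \<in> range (\<lambda>i. x $ i) \<Longrightarrow> real m * y \<in> \<int>"
    by (rule Rats_common_denominator[of "range (\<lambda>i. x $ i)"]) (use assms in \<open>auto simp: rational_vec_def\<close>)
  then have "m > 0 \<and> (\<forall>i. real m * x $ i \<in> \<int>)" by auto
  then have "den x > 0 \<and> (\<forall>i. real (den x) * x $ i \<in> \<int>)"
    unfolding den_def by (rule LeastI)
  then show "den x > 0" "int_vec (real (den x) *\<^sub>R x)" by (auto simp: int_vec_def)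
qed

text \<open>The numbers that clear the denominators of \<open>x\<close> are closed under remainders,
  and no positive one lies below the least.\<close>

lemma den_dvd:
  assumes "rational_vec x" "int_vec (real d *\<^sub>R x)"
  shows "den x dvd d"
proof -
  define r where "r = d mod den x"
  have "real d = real (d div den x) * real (den x) + real r"
    unfolding r_def by (metis div_mult_mod_eq of_nat_add of_nat_mult)
  then have "real r *\<^sub>R x = real d *\<^sub>R x - real (d div den x) *\<^sub>R (real (den x) *\<^sub>R x)"
    by (simp add: algebra_simps)
  moreover have "int_vec (real d *\<^sub>R x - real (d div den x) *\<^sub>R (real (den x) *\<^sub>R x))"
    by (rule int_vec_diff[OF assms(2) int_vec_scaleR[OF _ den_rational_vec(2)[OF assms(1)]]]) simp
  ultimately have "int_vec (real r *\<^sub>R x)" by (simp only:)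
  then have ints: "\<forall>i. real r * x $ i \<in> \<int>" by (simp add: int_vec_def)
  have "r = 0"
  proof (rule ccontr)
    assume "r \<noteq> 0"
    then have "den x \<le> r" unfolding den_def using ints by (intro Least_le) auto
    then show False using mod_less_divisor[OF den_rational_vec(1)[OF assms(1)], of d] by (simp add: r_def)
  qed
  then show ?thesis by (simp add: r_def mod_eq_0_iff_dvd)
qed

text \<open>By Bezout, \<open>a * den v + b * den w = 1\<close>, so the integral combination of the
  integer vectors \<open>den v * v\<close> and \<open>den w * w\<close> with coefficients
  \<open>a\<close> and \<open>b\<close> is an affine combination of \<open>v\<close> and
  \<open>w\<close>.\<close>

lemma coprime_den_int_point:
  assumes "rational_vec v" "rational_vec w" "gcd (den v) (den w) = 1"
  obtains z r where "int_vec z" "z = v + r *\<^sub>R (w - v)"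
proof -
  obtain a b :: int where ab: "a * int (den v) + b * int (den w) = 1"
    using bezout_int[of "int (den v)" "int (den w)"] assms(3) by (metis gcd_int_int_eq of_nat_1)
  have a: "of_int a * real (den v) = 1 - of_int b * real (den w)"
  proof -
    have "real_of_int (a * int (den v) + b * int (den w)) = 1" unfolding ab by simp
    then show ?thesis by simp
  qed
  let ?z = "of_int a *\<^sub>R (real (den v) *\<^sub>R v) + of_int b *\<^sub>R (real (den w) *\<^sub>R w)"
  have "int_vec ?z"
    by (rule int_vec_add; rule int_vec_scaleR[OF _ den_rational_vec(2)]) (use assms in simp_all)
  moreover have "?z = v + (of_int b * real (den w)) *\<^sub>R (w - v)"
    unfolding scaleR_scaleR a by (simp add: algebra_simps)
  ultimately show ?thesis using that by blast
qed

section \<open>Polyhedra as graphs of elementary segments\<close>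

text \<open>Edges are ordered pairs and may occur in both orientations, hence the comparison as
  unordered pairs. Isolated vertices are permitted, so the associated polyhedron is
  \<open>W \<union> segs E\<close>; this covers a single point.\<close>

definition seg_graph :: "(real ^ 'n) set \<Rightarrow> ((real ^ 'n) \<times> (real ^ 'n)) set \<Rightarrow> bool"
  where "seg_graph W E \<longleftrightarrow> finite W \<and> E \<subseteq> W \<times> W \<and>
    (\<forall>(u, w)\<in>E. u \<noteq> w \<and> open_segment u w \<inter> W = {}) \<and>
    (\<forall>(u, w)\<in>E. \<forall>(u', w')\<in>E. open_segment u w \<inter> closed_segment u' w' \<noteq> {} \<longrightarrow> {u, w} = {u', w'})"

definition segs :: "((real ^ 'n) \<times> (real ^ 'n)) set \<Rightarrow> (real ^ 'n) set"
  where "segs E = (\<Union>(u, w)\<in>E. closed_segment u w)"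

lemma closed_segs: "finite E \<Longrightarrow> closed (segs E)"
  unfolding segs_def by (intro closed_UN) auto

lemma seg_graph_finite: "seg_graph W E \<Longrightarrow> finite E"
  unfolding seg_graph_def using finite_subset by blast

text \<open>Vertices are the given point, the ends of the segments and the crossings that are single
  points. Segments sharing more than one point are collinear, and the ends of their overlap are
  vertices already.\<close>

lemma seg_graph_exists:
  fixes P :: "(real ^ 'n) set"
  assumes fin: "finite S" and rat: "\<And>a b. (a, b) \<in> S \<Longrightarrow> rational_vec a \<and> rational_vec b"
    and P: "P = segs S" and c: "c \<in> P" "rational_vec c"
  obtains W E where "seg_graph W E" "\<And>w. w \<in> W \<Longrightarrow> rational_vec w" "c \<in> W" "P = W \<union> segs E"
proof -
  define cr where "cr = {x. \<exists>(a, b)\<in>S. \<exists>(a', b')\<in>S. closed_segment a b \<inter> closed_segment a' b' = {x}}"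
  define W where "W = {c} \<union> fst ` S \<union> snd ` S \<union> cr"
  define E where "E = {(u, w). u \<in> W \<and> w \<in> W \<and> u \<noteq> w \<and> open_segment u w \<inter> W = {} \<and>
    (\<exists>(a, b)\<in>S. closed_segment u w \<subseteq> closed_segment a b)}"
  have "cr \<subseteq> (\<lambda>((a, b), (a', b')). the_elem (closed_segment a b \<inter> closed_segment a' b')) ` (S \<times> S)"
  proof
    fix x assume "x \<in> cr"
    then obtain a b a' b' where "(a, b) \<in> S" "(a', b') \<in> S" "closed_segment a b \<inter> closed_segment a' b' = {x}"
      unfolding cr_def by blast
    then show "x \<in> (\<lambda>((a, b), (a', b')). the_elem (closed_segment a b \<inter> closed_segment a' b')) ` (S \<times> S)"
      by (intro image_eqI[of _ _ "((a, b), (a', b'))"]) auto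
  qed
  then have "finite cr" using fin finite_subset by blast
  then have finW: "finite W" using fin by (simp add: W_def)
  have endsW: "a \<in> W" "b \<in> W" if "(a, b) \<in> S" for a b
    using that unfolding W_def by force+
  show ?thesis
  proof (rule that)
    show "rational_vec w" if "w \<in> W" for w
    proof -
      consider "w = c" | a b where "(a, b) \<in> S" "w = a \<or> w = b" | "w \<in> cr"
        using \<open>w \<in> W\<close> unfolding W_def by force
      then show ?thesis
      proof cases
        case 3
        then obtain a b a' b' where "(a, b) \<in> S" "(a', b') \<in> S" "closed_segment a b \<inter> closed_segment a' b' = {w}"
          unfolding cr_def by blast
        then show ?thesis using rational_segments_Int rat by blast
      qed (use c rat in blast)+
    qed
    show "c \<in> W" by (simp add: W_def)
    have "cr \<subseteq> P" unfolding cr_def P segs_def by blast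
    moreover have "fst ` S \<subseteq> P" "snd ` S \<subseteq> P" unfolding P segs_def by force+
    ultimately have "W \<subseteq> P" using c unfolding W_def by auto
    moreover have "segs E \<subseteq> P" unfolding P segs_def E_def by blast
    moreover have "x \<in> segs E" if x: "x \<in> P" "x \<notin> W" for x
    proof -
      obtain a b where ab: "(a, b) \<in> S" "x \<in> closed_segment a b" using x unfolding P segs_def by blast
      then obtain u w where "u \<in> W" "w \<in> W" "u \<noteq> w" "open_segment u w \<inter> W = {}" "x \<in> closed_segment u w"
        "closed_segment u w \<subseteq> closed_segment a b"
        using segment_subdivision[OF finW endsW[OF ab(1)] ab(2) x(2)] by blast
      then show ?thesis unfolding segs_def E_def using ab(1) by blast
    qed
    ultimately show "P = W \<union> segs E" by blast
    have "{u, w} = {u', w'}" if e: "(u, w) \<in> E" "(u', w') \<in> E"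
      and x: "x \<in> open_segment u w" "x \<in> closed_segment u' w'" for u w u' w' x
    proof -
      have W: "u \<in> W" "w \<in> W" "u' \<in> W" "w' \<in> W" "open_segment u w \<inter> W = {}" "open_segment u' w' \<inter> W = {}"
        using e unfolding E_def by auto
      obtain a b where ab: "(a, b) \<in> S" "closed_segment u w \<subseteq> closed_segment a b" using e unfolding E_def by blast
      obtain a' b' where ab': "(a', b') \<in> S" "closed_segment u' w' \<subseteq> closed_segment a' b'" using e unfolding E_def by blast
      have xs: "x \<in> closed_segment a b" "x \<in> closed_segment a' b'"
        using x ab ab' open_closed_segment by blast+
      \<comment> \<open>An inner point of an edge is no vertex, hence no crossing, so the two
        original segments share a second point \<open>y\<close>, and all four ends lie on the line
        through \<open>x\<close> and \<open>y\<close>.\<close>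
      have "x \<notin> cr" using x W unfolding W_def by blast
      then have "closed_segment a b \<inter> closed_segment a' b' \<noteq> {x}" using ab(1) ab'(1) unfolding cr_def by blast
      then obtain y where y: "y \<in> closed_segment a b" "y \<in> closed_segment a' b'" "x \<noteq> y" using xs by blast
      have ends: "u \<in> closed_segment a b" "w \<in> closed_segment a b" "u' \<in> closed_segment a' b'" "w' \<in> closed_segment a' b'"
        using ab(2) ab'(2) by auto
      obtain \<alpha> where "u = x + \<alpha> *\<^sub>R (y - x)" using closed_segment_line[OF xs(1) y(1) ends(1) y(3)] .
      moreover obtain \<beta> where "w = x + \<beta> *\<^sub>R (y - x)" using closed_segment_line[OF xs(1) y(1) ends(2) y(3)] .
      moreover obtain \<alpha>' where "u' = x + \<alpha>' *\<^sub>R (y - x)" using closed_segment_line[OF xs(2) y(2) ends(3) y(3)] .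
      moreover obtain \<beta>' where "w' = x + \<beta>' *\<^sub>R (y - x)" using closed_segment_line[OF xs(2) y(2) ends(4) y(3)] .
      ultimately show ?thesis by (rule elementary_segments_eq[OF W x])
    qed
    then have "\<forall>(u, w)\<in>E. \<forall>(u', w')\<in>E. open_segment u w \<inter> closed_segment u' w' \<noteq> {} \<longrightarrow> {u, w} = {u', w'}"
      by blast
    moreover have "E \<subseteq> W \<times> W" "\<forall>(u, w)\<in>E. u \<noteq> w \<and> open_segment u w \<inter> W = {}" by (auto simp: E_def)
    ultimately show "seg_graph W E" unfolding seg_graph_def using finW by blast
  qed
qed

text \<open>\<open>C\<close> consists of the vertices and of the edges with other ends, so that both
  orientations of the edge disappear. Its closedness serves the exclusion of cycles and the local
  analysis at a midpoint.\<close>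

lemma seg_graph_complement:
  assumes G: "seg_graph W E" and e: "(u, w) \<in> E"
  obtains C where "closed C" "W \<union> segs E = C \<union> open_segment u w" "C \<inter> open_segment u w = {}"
    "W \<subseteq> C" "\<And>E'. E' \<subseteq> E \<Longrightarrow> open_segment u w \<inter> segs E' = {} \<Longrightarrow> segs E' \<subseteq> C"
proof -
  define C where "C = W \<union> segs {(u', w') \<in> E. {u', w'} \<noteq> {u, w}}"
  have uw: "u \<in> W" "w \<in> W" "open_segment u w \<inter> W = {}" "u \<noteq> w" "finite W" using G e unfolding seg_graph_def by auto
  have G4: "{u, w} = {u', w'}" if "(u', w') \<in> E" "x \<in> open_segment u w" "x \<in> closed_segment u' w'" for u' w' x
    using G e that unfolding seg_graph_def by blast
  have sub: "closed_segment u' w' \<subseteq> C" if "(u', w') \<in> E" "{u', w'} \<noteq> {u, w}" for u' w'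
    using that unfolding C_def segs_def by blast
  have same: "closed_segment u' w' = closed_segment u w" if "{u', w'} = {u, w}" for u' w'
    using that closed_segment_commute by (metis doubleton_eq_iff)
  show ?thesis
  proof (rule that[of C])
    show "closed C" unfolding C_def
      using uw(5) by (intro closed_Un closed_segs finite_imp_closed finite_subset[OF _ seg_graph_finite[OF G]]) auto
    show "C \<inter> open_segment u w = {}"
      using uw(3) G4 unfolding C_def segs_def by fast
    show "W \<subseteq> C" by (simp add: C_def)
    have CC: "closed_segment u w \<subseteq> C \<union> open_segment u w"
      using uw unfolding C_def closed_segment_eq_open by blast
    have "closed_segment u' w' \<subseteq> C \<union> open_segment u w" if "(u', w') \<in> E" for u' w'
      using sub[OF that] same CC by blast
    then have "W \<union> segs E \<subseteq> C \<union> open_segment u w" unfolding segs_def C_def by blast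
    moreover have "C \<union> open_segment u w \<subseteq> W \<union> segs E"
      using e open_closed_segment unfolding C_def segs_def by blast
    ultimately show "W \<union> segs E = C \<union> open_segment u w" by (rule subset_antisym)
    show "segs E' \<subseteq> C" if E': "E' \<subseteq> E" "open_segment u w \<inter> segs E' = {}" for E'
    proof -
      have "{u', w'} \<noteq> {u, w}" if "(u', w') \<in> E'" for u' w'
      proof
        assume "{u', w'} = {u, w}"
        then have "closed_segment u w \<subseteq> segs E'" using same that unfolding segs_def by blast
        moreover have "open_segment u w \<noteq> {}" using uw(4) by simp
        ultimately show False using E'(2) open_closed_segment by blast
      qed
      then show ?thesis using E'(1) sub unfolding segs_def by blast
    qed
  qed
qed

text \<open>Near the midpoint of an edge the polyhedron is nothing but that edge, so the nearby
  rational point with coprime denominator granted by strong regularity lies on the same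
  line.\<close>

lemma seg_graph_int_point:
  assumes G: "seg_graph W E" and e: "(u, w) \<in> E" and rat: "\<And>w. w \<in> W \<Longrightarrow> rational_vec w"
    and sr: "strongly_regular (W \<union> segs E)"
  obtains z r where "int_vec z" "z = u + r *\<^sub>R (w - u)"
proof -
  obtain C where C: "closed C" "W \<union> segs E = C \<union> open_segment u w" "C \<inter> open_segment u w = {}"
    using seg_graph_complement[OF G e] by metis
  have uw: "u \<in> W" "w \<in> W" "u \<noteq> w" using G e unfolding seg_graph_def by auto
  define v where "v = midpoint u w"
  have v: "v \<in> open_segment u w" using uw by (simp add: v_def)
  have rv: "rational_vec v"
    using rat uw unfolding v_def midpoint_def by (auto intro!: rational_vec_scaleR rational_vec_add)
  have "v \<notin> C" using v C(3) by blast
  then obtain \<delta> where \<delta>: "\<delta> > 0" "ball v \<delta> \<inter> C = {}"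
    using C(1) by (metis Compl_iff disjoint_eq_subset_Compl open_Compl open_contains_ball)
  have vP: "v \<in> W \<union> segs E" using v C(2) by blast
  have "\<forall>v\<in>W \<union> segs E. rational_vec v \<longrightarrow> (\<forall>\<delta>>0. \<exists>w\<in>W \<union> segs E. rational_vec w \<and> dist v w < \<delta> \<and> gcd (den v) (den w) = 1)"
    using sr unfolding strongly_regular_def by (rule conjunct2)
  from this[rule_format, OF vP rv \<delta>(1)]
  obtain v' where v': "v' \<in> W \<union> segs E" "rational_vec v'" "dist v v' < \<delta>" "gcd (den v) (den v') = 1"
    by (elim bexE conjE) (rule that; assumption)
  have "v' \<in> ball v \<delta>" using v'(3) by simp
  then have "v' \<in> open_segment u w" using v'(1) C(2) \<delta>(2) by blast
  then obtain s t where st: "v = (1 - s) *\<^sub>R u + s *\<^sub>R w" "v' = (1 - t) *\<^sub>R u + t *\<^sub>R w"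
    using v unfolding in_segment by blast
  obtain z r where "int_vec z" "z = v + r *\<^sub>R (v' - v)"
    using coprime_den_int_point[OF rv v'(2,4)] by blast
  moreover have "v + r *\<^sub>R (v' - v) = u + (s + r * (t - s)) *\<^sub>R (w - u)"
    unfolding st by (simp add: algebra_simps)
  ultimately show ?thesis using that by metis
qed

lemma contractible_seg_graph_int_tree:
  assumes G: "seg_graph W E" and rat: "\<And>w. w \<in> W \<Longrightarrow> rational_vec w" and "1 \<in> W"
    and sr: "strongly_regular (W \<union> segs E)" and contr: "contractible (W \<union> segs E)"
  shows "\<exists>F. int_tree (W \<union> segs E) F"
proof -
  let ?P = "W \<union> segs E"
  have finE: "finite E" by (rule seg_graph_finite[OF G])
  have grow: "\<exists>F. int_tree ?P F"
    if "E' \<subseteq> E" "int_tree ({1} \<union> segs E') F" "connected ({1} \<union> segs E')" for E' F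
    using that
  proof (induction "card (E - E')" arbitrary: E' F rule: less_induct)
    case less
    let ?T = "{1} \<union> segs E'"
    show ?case
    proof (cases "?T = ?P")
      case True
      then show ?thesis using less.prems by metis
    next
      case False
      have TP: "?T \<subseteq> ?P" using \<open>1 \<in> W\<close> less.prems(1) unfolding segs_def by blast
      have fin': "finite E'" using less.prems(1) finE finite_subset by blast
      \<comment> \<open>Otherwise the edges that miss the current tree and the vertices outside it
        form a closed set disjoint from it, and the two would disconnect the polyhedron.\<close>
      have "\<exists>u w. (u, w) \<in> E \<and> closed_segment u w \<inter> ?T \<noteq> {} \<and> \<not> closed_segment u w \<subseteq> ?T"
      proof (rule ccontr)
        assume "\<not> ?thesis"
        then have no: "closed_segment u w \<inter> ?T = {} \<or> closed_segment u w \<subseteq> ?T" if "(u, w) \<in> E" for u w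
          using that by blast
        define R where "R = (W - ?T) \<union> segs {(u, w) \<in> E. closed_segment u w \<inter> ?T = {}}"
        have "finite (W - ?T)" using G unfolding seg_graph_def by blast
        then have R: "closed R" unfolding R_def
          by (intro closed_Un closed_segs finite_imp_closed finite_subset[OF _ finE]) auto
        have T: "closed ?T" using closed_segs[OF fin'] by (intro closed_Un) auto
        have cover: "?P \<subseteq> ?T \<union> R" using no unfolding R_def segs_def by blast
        have "?T \<inter> R = {}" unfolding R_def segs_def by blast
        then have "?T \<inter> ?P = {} \<or> R \<inter> ?P = {}"
          using connected_closedD[OF contractible_imp_connected[OF contr] _ cover T R] by blast
        then have "R \<inter> ?P = {}" using TP by blast
        then show False using cover TP False by blast
      qed
      then obtain u w where e: "(u, w) \<in> E" "closed_segment u w \<inter> ?T \<noteq> {}" "\<not> closed_segment u w \<subseteq> ?T"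
        by blast
      have uw: "u \<in> W" "w \<in> W" "u \<noteq> w" "open_segment u w \<inter> W = {}" using G e(1) unfolding seg_graph_def by auto
      have same: "closed_segment u' w' = closed_segment u w" if "{u, w} = {u', w'}" for u' w'
        using that closed_segment_commute by (metis doubleton_eq_iff)
      have disj: "open_segment u w \<inter> ?T = {}"
      proof (rule ccontr)
        assume "open_segment u w \<inter> ?T \<noteq> {}"
        then obtain x where x: "x \<in> open_segment u w" "x \<in> ?T" by blast
        have "x \<noteq> 1" using x(1) uw(4) \<open>1 \<in> W\<close> by blast
        then obtain u' w' where e': "(u', w') \<in> E'" "x \<in> closed_segment u' w'" using x(2) unfolding segs_def by blast
        then have "{u, w} = {u', w'}" using G e(1) less.prems(1) x(1) unfolding seg_graph_def by blast
        then have "closed_segment u w \<subseteq> ?T" using same e'(1) unfolding segs_def by blast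
        then show False using e(3) by blast
      qed
      have seg_eq: "closed_segment u w = open_segment u w \<union> {u, w}" by (rule closed_segment_eq_open)
      \<comment> \<open>With both ends in the connected part built so far, the edge would close a
        cycle.\<close>
      have not_both: "\<not> (u \<in> ?T \<and> w \<in> ?T)"
      proof
        assume both: "u \<in> ?T \<and> w \<in> ?T"
        obtain C where C: "closed C" "?P = C \<union> open_segment u w" "C \<inter> open_segment u w = {}"
          "W \<subseteq> C" "\<And>E'. E' \<subseteq> E \<Longrightarrow> open_segment u w \<inter> segs E' = {} \<Longrightarrow> segs E' \<subseteq> C"
          using seg_graph_complement[OF G e(1)] by blast
        have "?T \<subseteq> C" using C(4) C(5)[OF less.prems(1)] disj \<open>1 \<in> W\<close> by blast
        then show False
          using contractible_no_cycle[OF contr C(1-3) uw(3) less.prems(3)] both by blast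
      qed
      \<comment> \<open>The edge meets the tree only at its ends and not at both, so it is attached
        at exactly one end \<open>p\<close>, whatever its orientation.\<close>
      obtain p q where pq: "p \<in> ?T" "q \<notin> ?T" "{p, q} = {u, w}"
        using e(2) disj not_both unfolding seg_eq by blast
      have pq_seg: "closed_segment p q = closed_segment u w" using same pq(3) by metis
      have os: "open_segment p q = open_segment u w" using pq(3) open_segment_commute by (metis doubleton_eq_iff)
      have meet: "closed_segment p q \<inter> ?T = {p}"
        unfolding closed_segment_eq_open os using pq(1,2) disj by blast
      obtain z r where z: "int_vec z" "z = u + r *\<^sub>R (w - u)"
        using seg_graph_int_point[OF G e(1) rat sr] by blast
      obtain r' where z': "z = p + r' *\<^sub>R (q - p)"
      proof (cases "p = u")
        case True
        then have "q = w" using pq(3) by (metis doubleton_eq_iff)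
        then show ?thesis using that True z by blast
      next
        case False
        then have "p = w" "q = u" using pq(3) by (metis doubleton_eq_iff)+
        then have "z = p + (1 - r) *\<^sub>R (q - p)" using z by (simp add: algebra_simps)
        then show ?thesis by (rule that)
      qed
      have "{p, q} \<subseteq> W" unfolding pq(3) using uw by blast
      then have pqW: "p \<in> W" "q \<in> W" by auto
      obtain F' where F': "int_tree (?T \<union> closed_segment p q) F'"
        using int_tree_attach[OF less.prems(2) pq(1) rat[OF pqW(1)] rat[OF pqW(2)] _ meet z(1) z'] pq(1,2)
        by blast
      have T': "?T \<union> closed_segment p q = {1} \<union> segs (insert (u, w) E')"
        unfolding pq_seg segs_def by auto
      have "card (E - insert (u, w) E') < card (E - E')"
      proof (rule psubset_card_mono)
        have "(u, w) \<notin> E'" using e(3) unfolding segs_def by blast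
        then show "E - insert (u, w) E' \<subset> E - E'" using e(1) by blast
      qed (use finE in auto)
      moreover have "connected (?T \<union> closed_segment p q)"
      proof (rule connected_Un[OF less.prems(3)])
        show "?T \<inter> closed_segment p q \<noteq> {}" using meet by blast
      qed auto
      ultimately show ?thesis
        using less.hyps[of "insert (u, w) E'" F'] less.prems(1) e(1) F' unfolding T' by blast
    qed
  qed
  obtain F where "int_tree ({1} :: (real ^ 'a) set) F" using int_tree_point by blast
  moreover have "segs {} = ({} :: (real ^ 'a) set)" by (simp add: segs_def)
  ultimately show ?thesis using grow[of "{}" F] by simp
qed

lemma one_dim_retract:
  fixes P :: "(real ^ 'n) set"
  assumes "rational_polyhedron P" "pointed P" "polyhedron_dim P \<le> 1" "contractible P" "strongly_regular P"
  shows "pointed_Z_retract P"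
proof -
  obtain S where S: "finite S" "\<And>a b. (a, b) \<in> S \<Longrightarrow> rational_vec a \<and> rational_vec b"
    "P = (\<Union>(a, b)\<in>S. closed_segment a b)"
    by (rule one_dim_polyhedron_segments[OF assms(1) assms(3)]) (rule that; blast)
  have P: "1 \<in> P" "P \<subseteq> unit_cube" using assms(2) by (auto simp: pointed_def)
  obtain W E where G: "seg_graph W E" "\<And>w. w \<in> W \<Longrightarrow> rational_vec w" "1 \<in> W" "P = W \<union> segs E"
    using seg_graph_exists[OF S(1,2) _ P(1) int_vec_imp_rational_vec[OF int_vec_1]] S(3)
    unfolding segs_def by blast
  then obtain F where "int_tree P F"
    using contractible_seg_graph_int_tree[OF G(1,2,3)] assms(4,5) by blast
  then show ?thesis using int_tree_retract P(2) by blast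
qed

section \<open>Fixed points of integer piecewise linear maps\<close>

definition int_affine :: "(int ^ 'n) \<times> int \<Rightarrow> real ^ 'n \<Rightarrow> real"
  where "int_affine h x = (\<Sum>i\<in>UNIV. of_int (fst h $ i) * x $ i) + of_int (snd h)"

lemma int_affine_inner: "int_affine h x = (\<chi> i. of_int (fst h $ i)) \<bullet> x + of_int (snd h)"
  by (simp add: int_affine_def inner_vec_def)

lemma int_affine_line: "int_affine h (x + t *\<^sub>R (y - x)) = int_affine h x + t * (int_affine h y - int_affine h x)"
  by (simp add: int_affine_inner inner_add_right inner_diff_right)

lemma int_affine_convex: "int_affine h ((1 - t) *\<^sub>R x + t *\<^sub>R y) = (1 - t) * int_affine h x + t * int_affine h y"
  by (simp add: int_affine_inner inner_add_right algebra_simps)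

lemma int_affine_diff: "int_affine (fst h - fst k, snd h - snd k) x = int_affine h x - int_affine k x"
  by (simp add: int_affine_def algebra_simps sum_subtractf)

lemma int_affine_axis: "int_affine (axis j 1, 0) x = x $ j"
proof -
  have "(\<chi> i. real_of_int ((axis j 1 :: int ^ 'a) $ i)) = axis j 1" by (simp add: axis_def vec_eq_iff)
  then show ?thesis by (simp add: int_affine_inner inner_axis')
qed

lemma int_affine_const: "int_affine (0, b) x = of_int b"
  by (simp add: int_affine_def)

lemma continuous_on_int_affine: "continuous_on S (int_affine h)"
  unfolding int_affine_inner[abs_def] by (intro continuous_intros)

lemma pil_int_affineE:
  assumes "piecewise_int_linear_on S f"
  obtains L where "finite L" "\<And>x. x \<in> S \<Longrightarrow> \<exists>l\<in>L. f x = int_affine l x"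
  using assms unfolding piecewise_int_linear_on_def int_affine_def by (auto simp: case_prod_beta)

text \<open>The tight constraints determine an extreme point: a second solution \<open>y\<close>
  would allow small moves in both directions along \<open>y - x\<close>. The rational projection of
  the coordinates of \<open>x\<close> solves the same integral equations, so it equals
  \<open>x\<close>.\<close>

lemma extreme_point_rational:
  fixes H :: "((int ^ 'n) \<times> int) set"
  assumes "finite H" and x: "x extreme_point_of {y. \<forall>h\<in>H. 0 \<le> int_affine h y}" (is "x extreme_point_of ?Q")
  shows "rational_vec x"
proof -
  have xQ: "\<And>h. h \<in> H \<Longrightarrow> 0 \<le> int_affine h x" using x by (auto simp: extreme_point_of_def)
  have uniq: "y = x" if y: "\<And>h. h \<in> H \<Longrightarrow> int_affine h x = 0 \<Longrightarrow> int_affine h y = 0" for y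
  proof (rule ccontr)
    assume "y \<noteq> x"
    \<comment> \<open>Tight constraints vanish along the whole line and slack ones survive small
      moves; the values 1 and -1 of \<open>s\<close> give the two directions.\<close>
    have stays: "\<forall>\<^sub>F \<epsilon> in at_right 0. \<forall>h\<in>H. 0 \<le> int_affine h (x + (s * \<epsilon>) *\<^sub>R (y - x))" for s :: real
    proof (rule eventually_ball_finite[OF \<open>finite H\<close>], rule ballI)
      fix h assume h: "h \<in> H"
      show "\<forall>\<^sub>F \<epsilon> in at_right 0. 0 \<le> int_affine h (x + (s * \<epsilon>) *\<^sub>R (y - x))"
      proof (cases "int_affine h x = 0")
        case True
        then show ?thesis using y[OF h] int_affine_line[of h x _ y] by simp
      next
        case False
        then have pos: "0 < int_affine h x" using xQ[OF h] by simp
        have "((\<lambda>\<epsilon>. int_affine h x + (s * \<epsilon>) * (int_affine h y - int_affine h x)) \<longlongrightarrow>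
            int_affine h x + (s * 0) * (int_affine h y - int_affine h x)) (at_right 0)"
          by (intro tendsto_intros)
        then have "\<forall>\<^sub>F \<epsilon> in at_right 0. 0 < int_affine h x + (s * \<epsilon>) * (int_affine h y - int_affine h x)"
          using pos by (intro order_tendstoD) auto
        then show ?thesis by eventually_elim (simp add: int_affine_line)
      qed
    qed
    obtain \<epsilon> :: real where "(\<forall>h\<in>H. 0 \<le> int_affine h (x + (1 * \<epsilon>) *\<^sub>R (y - x))) \<and>
        (\<forall>h\<in>H. 0 \<le> int_affine h (x + ((-1) * \<epsilon>) *\<^sub>R (y - x))) \<and> 0 < \<epsilon>"
      using eventually_happens'[OF trivial_limit_at_right_real
          eventually_conj[OF stays[of 1] eventually_conj[OF stays[of "-1"] eventually_at_right_less[of 0]]]] ..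
    then have \<epsilon>: "\<epsilon> > 0" "x + \<epsilon> *\<^sub>R (y - x) \<in> ?Q" "x - \<epsilon> *\<^sub>R (y - x) \<in> ?Q" by simp_all
    have "midpoint (x - \<epsilon> *\<^sub>R (y - x)) (x + \<epsilon> *\<^sub>R (y - x)) = x"
      by (simp add: midpoint_def flip: scaleR_2)
    moreover have "x - \<epsilon> *\<^sub>R (y - x) \<noteq> x + \<epsilon> *\<^sub>R (y - x)"
    proof
      assume eq: "x - \<epsilon> *\<^sub>R (y - x) = x + \<epsilon> *\<^sub>R (y - x)"
      have "2 *\<^sub>R (\<epsilon> *\<^sub>R (y - x)) = (x + \<epsilon> *\<^sub>R (y - x)) - (x - \<epsilon> *\<^sub>R (y - x))"
        unfolding scaleR_2 by simp
      also have "\<dots> = 0" unfolding eq by simp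
      finally have "2 *\<^sub>R (\<epsilon> *\<^sub>R (y - x)) = 0" .
      then show False using \<epsilon>(1) \<open>y \<noteq> x\<close> by simp
    qed
    ultimately have "x \<in> open_segment (x - \<epsilon> *\<^sub>R (y - x)) (x + \<epsilon> *\<^sub>R (y - x))"
      by (metis midpoint_in_open_segment)
    then show False using x \<epsilon>(2,3) unfolding extreme_point_of_def by blast
  qed
  obtain \<pi> :: "real \<Rightarrow> real" where \<pi>: "\<And>x y. \<pi> (x + y) = \<pi> x + \<pi> y"
    "\<And>q x. q \<in> \<rat> \<Longrightarrow> \<pi> (q * x) = q * \<pi> x" "\<pi> 1 = 1" "\<And>x. \<pi> x \<in> \<rat>"
    using rational_projection by blast
  have \<pi>0: "\<pi> 0 = 0" using \<pi>(2)[of 0 0] by simp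
  have \<pi>_sum: "\<pi> (sum f A) = (\<Sum>i\<in>A. \<pi> (f i))" for f :: "'n \<Rightarrow> real" and A
    by (induction A rule: infinite_finite_induct) (auto simp: \<pi>0 \<pi>(1))
  have \<pi>_int: "\<pi> (of_int k) = of_int k" for k using \<pi>(2)[of "of_int k" 1] \<pi>(3) by simp
  have "(\<chi> i. \<pi> (x $ i)) = x"
  proof (rule uniq)
    fix h assume "int_affine h x = 0"
    have "int_affine h (\<chi> i. \<pi> (x $ i)) = \<pi> (int_affine h x)"
      by (simp add: int_affine_def \<pi>(1) \<pi>_sum \<pi>_int \<pi>(2))
    then show "int_affine h (\<chi> i. \<pi> (x $ i)) = 0" using \<open>int_affine h x = 0\<close> \<pi>0 by simp
  qed
  then show ?thesis using \<pi>(4) unfolding rational_vec_def by (metis vec_lambda_beta)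
qed

lemma rational_polytope:
  fixes H :: "((int ^ 'n) \<times> int) set"
  assumes "finite H" "bounded {x. \<forall>h\<in>H. 0 \<le> int_affine h x}"
  obtains V where "finite V" "\<And>v. v \<in> V \<Longrightarrow> rational_vec v" "{x. \<forall>h\<in>H. 0 \<le> int_affine h x} = convex hull V"
proof -
  let ?Q = "{x. \<forall>h\<in>H. 0 \<le> int_affine h x}"
  have Q: "?Q = \<Inter>((\<lambda>h. {x. 0 \<le> int_affine h x}) ` H)" by auto
  have "polyhedron {x. 0 \<le> int_affine h x}" for h :: "(int ^ 'n) \<times> int"
  proof -
    have "{x. 0 \<le> int_affine h x} = {x. (\<chi> i. of_int (fst h $ i)) \<bullet> x \<ge> - of_int (snd h)}"
      by (auto simp: int_affine_inner)
    then show ?thesis using polyhedron_halfspace_ge by metis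
  qed
  then have poly: "polyhedron ?Q" unfolding Q using assms(1) by (intro polyhedron_Inter) auto
  have "compact ?Q" using assms(2) polyhedron_imp_closed[OF poly] by (simp add: compact_eq_bounded_closed)
  then have "?Q = convex hull {x. x extreme_point_of ?Q}"
    using polyhedron_imp_convex[OF poly] by (rule Krein_Milman_Minkowski)
  then show ?thesis
    using that[of "{x. x extreme_point_of ?Q}"] finite_polyhedron_extreme_points[OF poly]
      extreme_point_rational[OF assms(1)] by blast
qed

section \<open>Cells of an integral hyperplane arrangement\<close>

definition sign_cell :: "((int ^ 'n) \<times> int) set \<Rightarrow> real ^ 'n \<Rightarrow> (real ^ 'n) set"
  where "sign_cell H x = {y. \<forall>h\<in>H. sgn (int_affine h y) = sgn (int_affine h x)}"

text \<open>The closure of \<open>sign_cell H x\<close>, written with non-strict inequalities so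
  that for finite \<open>H\<close> it is cut out by finitely many integral half-spaces. Where the
  value at \<open>x\<close> is 0, both implications apply and force equality.\<close>

definition weak_cell :: "((int ^ 'n) \<times> int) set \<Rightarrow> real ^ 'n \<Rightarrow> (real ^ 'n) set"
  where "weak_cell H x = {y. \<forall>h\<in>H. (0 \<le> int_affine h x \<longrightarrow> 0 \<le> int_affine h y) \<and> (int_affine h x \<le> 0 \<longrightarrow> int_affine h y \<le> 0)}"

lemma sign_cell_convex: "convex (sign_cell H x)"
  unfolding convex_alt
proof (intro ballI allI impI)
  fix y z and t :: real assume yz: "y \<in> sign_cell H x" "z \<in> sign_cell H x" "0 \<le> t \<and> t \<le> 1"
  have "sgn (int_affine h ((1 - t) *\<^sub>R y + t *\<^sub>R z)) = sgn (int_affine h x)" if "h \<in> H" for h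
  proof -
    have s: "sgn (int_affine h y) = sgn (int_affine h x)" "sgn (int_affine h z) = sgn (int_affine h x)"
      using yz that by (auto simp: sign_cell_def)
    have t: "t = 1 \<or> 0 < 1 - t" "0 \<le> t" using yz by auto
    consider "int_affine h x = 0" | "int_affine h x > 0" | "int_affine h x < 0" by linarith
    then show ?thesis
    proof cases
      case 1
      then show ?thesis using s by (simp add: int_affine_convex sgn_zero_iff)
    next
      case 2
      then have "int_affine h y > 0" "int_affine h z > 0" using s by (simp_all add: sgn_1_pos)
      then have "0 < (1 - t) * int_affine h y + t * int_affine h z"
        using t by (auto intro: add_pos_nonneg)
      then show ?thesis using 2 by (simp add: int_affine_convex)
    next
      case 3
      then have "int_affine h y < 0" "int_affine h z < 0" using s by (simp_all add: sgn_1_neg)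
      then have "(1 - t) * int_affine h y + t * int_affine h z < 0"
        using t add_neg_nonpos[OF mult_pos_neg mult_nonneg_nonpos, of "1 - t" "int_affine h y" t "int_affine h z"]
        by auto
      then show ?thesis using 3 by (simp add: int_affine_convex)
    qed
  qed
  then show "(1 - t) *\<^sub>R y + t *\<^sub>R z \<in> sign_cell H x" by (simp add: sign_cell_def)
qed

lemma sign_cell_subset_weak_cell: "sign_cell H x \<subseteq> weak_cell H x"
proof
  fix y assume y: "y \<in> sign_cell H x"
  have "(0 \<le> a \<longrightarrow> 0 \<le> b) \<and> (a \<le> 0 \<longrightarrow> b \<le> 0)" if "sgn b = sgn a" for a b :: real
    using that by (auto simp: sgn_if split: if_splits)
  then show "y \<in> weak_cell H x" using y unfolding weak_cell_def sign_cell_def by blast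
qed

text \<open>On the way from a point of the weak cell to \<open>x\<close>, every point after the
  start already has the signs of \<open>x\<close>.\<close>

lemma weak_cell_subset_closure: "weak_cell H x \<subseteq> closure (sign_cell H x)"
proof
  fix y assume y: "y \<in> weak_cell H x"
  have "y + t *\<^sub>R (x - y) \<in> sign_cell H x" if t: "0 < t" "t < 1" for t
  proof -
    have "sgn (int_affine h (y + t *\<^sub>R (x - y))) = sgn (int_affine h x)" if h: "h \<in> H" for h
    proof -
      have eq: "int_affine h (y + t *\<^sub>R (x - y)) = (1 - t) * int_affine h y + t * int_affine h x"
        unfolding int_affine_line by (simp add: algebra_simps)
      have w: "(0 \<le> int_affine h x \<longrightarrow> 0 \<le> int_affine h y) \<and> (int_affine h x \<le> 0 \<longrightarrow> int_affine h y \<le> 0)"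
        using y h by (simp add: weak_cell_def)
      consider "int_affine h x = 0" | "int_affine h x > 0" | "int_affine h x < 0" by linarith
      then show ?thesis
      proof cases
        case 1
        then have "int_affine h y = 0" using w by simp
        then show ?thesis using 1 by (simp add: eq)
      next
        case 2
        then have "0 < (1 - t) * int_affine h y + t * int_affine h x" using w t by (intro add_nonneg_pos) auto
        then show ?thesis using 2 by (simp add: eq)
      next
        case 3
        then have "(1 - t) * int_affine h y + t * int_affine h x < 0" using w t
          by (intro add_nonpos_neg mult_nonneg_nonpos mult_pos_neg) auto
        then show ?thesis using 3 by (simp add: eq)
      qed
    qed
    then show ?thesis by (simp add: sign_cell_def)
  qed
  then have "\<forall>\<^sub>F t in at_right 0. y + t *\<^sub>R (x - y) \<in> closure (sign_cell H x)"
    using closure_subset by (intro eventually_at_rightI[of 0 1]) auto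
  moreover have "((\<lambda>t. y + t *\<^sub>R (x - y)) \<longlongrightarrow> y + 0 *\<^sub>R (x - y)) (at_right 0)"
    by (intro tendsto_intros)
  ultimately have "y + 0 *\<^sub>R (x - y) \<in> closure (sign_cell H x)"
    by (intro Lim_in_closed_set[OF closed_closure]) auto
  then show "y \<in> closure (sign_cell H x)" by simp
qed

lemma weak_cell_rational:
  fixes H :: "((int ^ 'n) \<times> int) set"
  assumes "finite H" "bounded (weak_cell H x)"
  obtains V where "finite V" "\<And>v. v \<in> V \<Longrightarrow> rational_vec v" "weak_cell H x = convex hull V"
proof -
  let ?neg = "\<lambda>h :: (int ^ 'n) \<times> int. (- fst h, - snd h)"
  let ?H = "{h \<in> H. 0 \<le> int_affine h x} \<union> ?neg ` {h \<in> H. int_affine h x \<le> 0}"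
  have neg: "int_affine (?neg h) y = - int_affine h y" for h :: "(int ^ 'n) \<times> int" and y
    by (simp add: int_affine_def sum_negf)
  have "weak_cell H x = {y. \<forall>h\<in>?H. 0 \<le> int_affine h y}"
    unfolding weak_cell_def ball_Un ball_simps neg by auto
  moreover have "finite ?H" using assms(1) by simp
  ultimately show ?thesis using rational_polytope[of ?H] that assms(2) by metis
qed

text \<open>A weak cell depends on \<open>x\<close> only through the subsets of \<open>H\<close>
  that are nonnegative and nonpositive at \<open>x\<close>.\<close>

lemma finite_weak_cells: "finite H \<Longrightarrow> finite (range (weak_cell H))"
proof -
  assume "finite H"
  let ?s = "\<lambda>x. ({h \<in> H. 0 \<le> int_affine h x}, {h \<in> H. int_affine h x \<le> 0})"
  have "weak_cell H x = (\<lambda>(A, B). {y. (\<forall>h\<in>A. 0 \<le> int_affine h y) \<and> (\<forall>h\<in>B. int_affine h y \<le> 0)}) (?s x)" for x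
    unfolding weak_cell_def by auto
  then have "range (weak_cell H) \<subseteq> (\<lambda>(A, B). {y. (\<forall>h\<in>A. 0 \<le> int_affine h y) \<and> (\<forall>h\<in>B. int_affine h y \<le> 0)}) ` (Pow H \<times> Pow H)"
    by (auto intro!: image_eqI[of _ _ "?s x" for x])
  then show ?thesis using \<open>finite H\<close> by (meson finite_Pow_iff finite_SigmaI finite_imageI finite_subset)
qed

text \<open>On a sign cell of the differences of the pieces, two pieces agree everywhere or nowhere, so by
  connectedness a single piece represents the function.\<close>
lemma sign_cell_single_piece:
  assumes "continuous_on R f" "connected R" and L: "finite L" "\<And>y. y \<in> R \<Longrightarrow> \<exists>l\<in>L. f y = int_affine l y"
    and R: "\<And>l l' y z. l \<in> L \<Longrightarrow> l' \<in> L \<Longrightarrow> y \<in> R \<Longrightarrow> z \<in> R \<Longrightarrow> int_affine l y = int_affine l' y \<Longrightarrow> int_affine l z = int_affine l' z"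
    and l: "l \<in> L" "x \<in> R" "f x = int_affine l x" and "y \<in> R"
  shows "f y = int_affine l y"
proof -
  have cl: "closedin (top_of_set R) {y \<in> R. f y = int_affine l y}" for l
  proof -
    have "closedin (top_of_set R) {y \<in> R. f y - int_affine l y = 0}"
      by (intro continuous_closedin_preimage_constant continuous_intros assms(1) continuous_on_int_affine)
    then show ?thesis by simp
  qed
  define A where "A = {y \<in> R. f y = int_affine l y}"
  \<comment> \<open>Where \<open>f\<close> follows a piece that differs from \<open>l\<close> at
    \<open>x\<close>. Pieces agreeing at one point of \<open>R\<close> agree at all of them, so
    \<open>B\<close> is disjoint from \<open>A\<close>; both are closed in \<open>R\<close>.\<close>
  define B where "B = (\<Union>l'\<in>{l' \<in> L. int_affine l' x \<noteq> int_affine l x}. {y \<in> R. f y = int_affine l' y})"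
  have A: "closedin (top_of_set R) A" unfolding A_def by (rule cl)
  have B: "closedin (top_of_set R) B" unfolding B_def
    using L(1) by (intro closedin_Union) (auto intro: cl)
  have "A \<inter> B = {}"
  proof (rule ccontr)
    assume "A \<inter> B \<noteq> {}"
    then obtain z l' where "z \<in> R" "l' \<in> L" "int_affine l' x \<noteq> int_affine l x" "int_affine l' z = int_affine l z"
      unfolding A_def B_def by auto
    then show False using R[of l' l z x] l by blast
  qed
  moreover have "R \<subseteq> A \<union> B"
  proof
    fix z assume z: "z \<in> R"
    obtain l' where l': "l' \<in> L" "f z = int_affine l' z" using L(2)[OF z] by blast
    show "z \<in> A \<union> B"
    proof (cases "int_affine l' x = int_affine l x")
      case True
      then have "int_affine l' z = int_affine l z" using R[OF l'(1) l(1) l(2) z] by simp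
      then show ?thesis using z l' by (simp add: A_def)
    next
      case False
      then show ?thesis unfolding B_def using z l' by blast
    qed
  qed
  moreover have "A \<noteq> {}" using l by (auto simp: A_def)
  ultimately have "B = {}" using A B \<open>connected R\<close> unfolding connected_closedin by blast
  then show ?thesis using \<open>R \<subseteq> A \<union> B\<close> \<open>y \<in> R\<close> by (auto simp: A_def)
qed

text \<open>If \<open>x\<close> is fixed then so is its sign cell, because one piece per component
  is active there and its difference from the coordinate has constant sign, namely 0. Continuity
  extends this to the closed cell, so the fixed points form a union of finitely many rational
  polytopes.\<close>

lemma Z_map_fixed_points_rational_polyhedron:
  fixes f :: "real ^ 'n \<Rightarrow> real ^ 'n"
  assumes "Z_map f"
  shows "rational_polyhedron {x \<in> unit_cube. f x = x}"
proof -
  let ?P = "{x \<in> unit_cube. f x = x}"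
  have cont: "continuous_on unit_cube f" and pil: "\<And>j. piecewise_int_linear_on unit_cube (\<lambda>x. f x $ j)"
    using assms by (auto simp: Z_map_def)
  have "\<exists>L. finite L \<and> (\<forall>x\<in>unit_cube. \<exists>l\<in>L. f x $ j = int_affine l x)" for j
    using pil_int_affineE[OF pil[of j]] by metis
  then obtain L where L: "\<And>j. finite (L j)" "\<And>j x. x \<in> unit_cube \<Longrightarrow> \<exists>l\<in>L j. f x $ j = int_affine l x"
    by metis
  define D where "D h k = (fst h - fst k, snd h - snd k)" for h k :: "(int ^ 'n) \<times> int"
  have D: "int_affine (D h k) x = int_affine h x - int_affine k x" for h k x
    unfolding D_def by (rule int_affine_diff)
  define X where "X j = (axis j 1 :: int ^ 'n, 0 :: int)" for j
  have X: "int_affine (X j) x = x $ j" for j x unfolding X_def by (rule int_affine_axis)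
  \<comment> \<open>Differences of pieces single out the active piece, differences of a piece and a
    coordinate detect fixed components, and the coordinates and their complements to 1 keep the
    cells inside the cube.\<close>
  define H where "H = (\<Union>j. (\<lambda>(l, l'). D l l') ` (L j \<times> L j) \<union> (\<lambda>l. D l (X j)) ` L j \<union> {X j, D (0, 1) (X j)})"
  have finH: "finite H" unfolding H_def using L(1) by auto
  have HI: "D l l' \<in> H" "D l (X j) \<in> H" if "l \<in> L j" "l' \<in> L j" for l l' j
    using that unfolding H_def by (auto intro!: exI[of _ j])
  have HX: "X j \<in> H" "D (0, 1) (X j) \<in> H" for j unfolding H_def by auto
  have weak_cube: "weak_cell H x \<subseteq> unit_cube" if "x \<in> unit_cube" for x
  proof
    fix y assume y: "y \<in> weak_cell H x"
    have "0 \<le> y $ j \<and> y $ j \<le> 1" for j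
    proof -
      have "0 \<le> int_affine (X j) x" "0 \<le> int_affine (D (0, 1) (X j)) x"
        using that by (auto simp: X D int_affine_const mem_box_cart)
      then have "0 \<le> int_affine (X j) y" "0 \<le> int_affine (D (0, 1) (X j)) y"
        using y HX[of j] unfolding weak_cell_def by auto
      then show ?thesis by (simp add: X D int_affine_const)
    qed
    then show "y \<in> unit_cube" by (simp add: mem_box_cart)
  qed
  have cell: "weak_cell H x \<subseteq> ?P" if x: "x \<in> ?P" for x
  proof -
    have xc: "x \<in> unit_cube" "f x = x" using x by auto
    have cube: "sign_cell H x \<subseteq> unit_cube"
      using sign_cell_subset_weak_cell weak_cube[OF xc(1)] by blast
    have xx: "x \<in> sign_cell H x" by (simp add: sign_cell_def)
    have "f y = y" if y: "y \<in> sign_cell H x" for y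
    proof -
      have "f y $ j = y $ j" for j
      proof -
        obtain l where l: "l \<in> L j" "f x $ j = int_affine l x" using L(2)[OF xc(1)] by blast
        have "f y $ j = int_affine l y"
        proof (rule sign_cell_single_piece[of "sign_cell H x" "\<lambda>x. f x $ j" "L j" l x])
          show "continuous_on (sign_cell H x) (\<lambda>x. f x $ j)"
            by (intro continuous_intros continuous_on_subset[OF cont cube])
          show "connected (sign_cell H x)" by (simp add: sign_cell_convex convex_connected)
          show "int_affine l z = int_affine l' z"
            if "l \<in> L j" "l' \<in> L j" "y \<in> sign_cell H x" "z \<in> sign_cell H x" "int_affine l y = int_affine l' y" for l l' y z
          proof -
            have "sgn (int_affine (D l l') z) = sgn (int_affine (D l l') y)"
              using that HI(1)[OF that(1,2)] by (simp add: sign_cell_def)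
            then show ?thesis using that(5) by (simp add: D sgn_zero_iff)
          qed
        qed (use L cube l xx y in auto)
        moreover have "sgn (int_affine (D l (X j)) y) = sgn (int_affine (D l (X j)) x)"
          using y HI(2)[OF l(1) l(1)] by (simp add: sign_cell_def)
        ultimately show ?thesis using l xc(2) by (simp add: D X sgn_zero_iff)
      qed
      then show ?thesis by (simp add: vec_eq_iff)
    qed
    then have "sign_cell H x \<subseteq> ?P" using cube by blast
    moreover have "closed ?P"
    proof -
      have "closed {x \<in> unit_cube. f x - x = 0}"
        by (intro continuous_closed_preimage_constant continuous_intros cont closed_cbox)
      then show ?thesis by simp
    qed
    ultimately show ?thesis using weak_cell_subset_closure closure_minimal by blast
  qed
  have "\<forall>C\<in>weak_cell H ` ?P. \<exists>V. finite V \<and> (\<forall>v\<in>V. rational_vec v) \<and> C = convex hull V"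
  proof
    fix C assume C: "C \<in> weak_cell H ` ?P"
    obtain x where x: "x \<in> ?P" "C = weak_cell H x" using C by blast
    then have "bounded (weak_cell H x)" using weak_cube[of x] bounded_cbox bounded_subset by blast
    then show "\<exists>V. finite V \<and> (\<forall>v\<in>V. rational_vec v) \<and> C = convex hull V"
      using weak_cell_rational[OF finH] x(2) by metis
  qed
  then obtain V where V: "\<forall>C\<in>weak_cell H ` ?P. finite (V C) \<and> (\<forall>v\<in>V C. rational_vec v) \<and> C = convex hull (V C)"
    by (rule bchoice[elim_format]) blast
  have "x \<in> weak_cell H x" for x by (simp add: weak_cell_def)
  then have "?P = \<Union>(weak_cell H ` ?P)" using cell by blast
  also have "\<dots> = (\<Union>W\<in>V ` weak_cell H ` ?P. convex hull W)" using V by auto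
  finally have "?P = (\<Union>W\<in>V ` weak_cell H ` ?P. convex hull W)" .
  moreover have "finite (V ` weak_cell H ` ?P)"
    using finite_weak_cells[OF finH] by (meson finite_imageI finite_subset image_mono subset_UNIV)
  ultimately show ?thesis unfolding rational_polyhedron_def using V
    by (intro exI[of _ "V ` weak_cell H ` ?P"]) auto
qed

section \<open>Denominators under integral maps and strong regularity\<close>

lemma Z_map_den:
  assumes "Z_map f" "x \<in> unit_cube" "rational_vec x"
  shows "rational_vec (f x)" "den (f x) dvd den x"
proof -
  have "f x $ j \<in> \<rat> \<and> real (den x) * f x $ j \<in> \<int>" for j
  proof -
    have "piecewise_int_linear_on unit_cube (\<lambda>x. f x $ j)" using assms(1) by (simp add: Z_map_def)
    then obtain L where "\<And>x. x \<in> unit_cube \<Longrightarrow> \<exists>l\<in>L. f x $ j = int_affine l x"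
      using pil_int_affineE by blast
    then obtain l where l: "f x $ j = int_affine l x" using assms(2) by blast
    let ?a = "\<chi> i. real_of_int (fst l $ i)"
    have a: "int_vec ?a" by (simp add: int_vec_def)
    have "f x $ j = ?a \<bullet> x + of_int (snd l)" using l by (simp add: int_affine_inner)
    moreover have "?a \<bullet> x \<in> \<rat>" using rational_vec_inner int_vec_imp_rational_vec[OF a] assms(3) by blast
    moreover have "?a \<bullet> (real (den x) *\<^sub>R x) \<in> \<int>" using int_vec_inner[OF a den_rational_vec(2)[OF assms(3)]] .
    ultimately show ?thesis by (auto simp: algebra_simps)
  qed
  then show r: "rational_vec (f x)" "den (f x) dvd den x"
    by (auto intro!: den_dvd simp: rational_vec_def int_vec_def)
qed

text \<open>Numbers congruent to 1 modulo \<open>n\<close> are coprime to \<open>n\<close> and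
  arbitrarily large. Rounding each coordinate down to a multiple of \<open>1 / q\<close> stays in
  the cube, and the denominator of the result divides \<open>q\<close>.\<close>

lemma coprime_den_approx:
  fixes v :: "real ^ 'n"
  assumes "v \<in> unit_cube" "n > 0" "\<delta> > 0"
  obtains w where "w \<in> unit_cube" "rational_vec w" "dist v w < \<delta>" "coprime n (den w)"
proof -
  \<comment> \<open>Chosen so that the sum of all coordinate errors, at most
    \<open>CARD('n) / q\<close>, is below \<delta>.\<close>
  obtain m :: nat where m: "real m > real CARD('n) / \<delta>" using reals_Archimedean2 by blast
  define q where "q = n * (m + 1) + 1"
  have "q > 0" by (simp add: q_def)
  then have q0: "real q > 0" by simp
  have "m \<le> n * (m + 1)" using assms(2) by (metis Suc_eq_plus1 Suc_leD mult_le_mono1 nat_mult_1 Suc_leI One_nat_def)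
  then have "real m \<le> real q" by (simp add: q_def del: of_nat_add of_nat_mult)
  then have q: "real q > real CARD('n) / \<delta>" using m by linarith
  define w :: "real ^ 'n" where "w = (\<chi> i. of_int \<lfloor>real q * v $ i\<rfloor> / real q)"
  have v01: "0 \<le> v $ i" "v $ i \<le> 1" for i using assms(1) by (auto simp: mem_box_cart)
  have w01: "0 \<le> w $ i" "w $ i \<le> v $ i" "v $ i \<le> w $ i + 1 / real q" for i
  proof -
    have fl: "of_int \<lfloor>real q * v $ i\<rfloor> \<le> real q * v $ i" "real q * v $ i < of_int \<lfloor>real q * v $ i\<rfloor> + 1" by linarith+
    have "0 \<le> \<lfloor>real q * v $ i\<rfloor>" using v01[of i] by simp
    then show "0 \<le> w $ i" using q0 by (simp add: w_def)
    show "w $ i \<le> v $ i" "v $ i \<le> w $ i + 1 / real q"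
      using fl q0 by (simp_all add: w_def field_simps)
  qed
  have rw: "rational_vec w" by (simp add: rational_vec_def w_def)
  show ?thesis
  proof (rule that[OF _ rw])
    show "w \<in> unit_cube" using w01 v01 by (auto simp: mem_box_cart) (meson order_trans)
    have "dist v w \<le> (\<Sum>i\<in>UNIV. \<bar>(v - w) $ i\<bar>)" unfolding dist_norm by (rule norm_le_l1_cart)
    also have "\<dots> \<le> (\<Sum>i\<in>(UNIV :: 'n set). 1 / real q)"
    proof (rule sum_mono)
      show "\<bar>(v - w) $ i\<bar> \<le> 1 / real q" for i
        using w01(2,3)[of i] unfolding vector_minus_component by linarith
    qed
    also have "\<dots> = real CARD('n) / real q" by simp
    also have "\<dots> < \<delta>" using q q0 assms(3) by (simp add: field_simps)
    finally show "dist v w < \<delta>" .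
    have "int_vec (real q *\<^sub>R w)" using q0 by (simp add: int_vec_def w_def)
    then have "den w dvd q" by (rule den_dvd[OF rw])
    moreover have "coprime n q"
    proof (rule coprimeI)
      fix k assume k: "k dvd n" "k dvd q"
      have "k dvd n * (m + 1)" using k(1) by (rule dvd_mult2)
      then show "is_unit k" using k(2) unfolding q_def by (simp only: dvd_add_right_iff)
    qed
    ultimately show "coprime n (den w)" using coprime_divisors dvd_refl by blast
  qed
qed

lemma pointed_Z_retract_contractible:
  assumes "pointed_Z_retract P"
  shows "contractible P"
proof -
  obtain \<zeta> where z: "pointed_Z_retraction \<zeta>" "P = \<zeta> ` unit_cube"
    using assms unfolding pointed_Z_retract_def by blast
  then have "retraction unit_cube P \<zeta>"
    unfolding retraction_def pointed_Z_retraction_def Z_map_def by auto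
  then have "P retract_of unit_cube" unfolding retract_of_def by blast
  then show ?thesis using retract_of_contractible convex_imp_contractible convex_box(1) by blast
qed

text \<open>A coprime approximation of \<open>v\<close> in the cube is pushed into \<open>P\<close>:
  continuity at the fixed point \<open>v\<close> keeps it close, and its denominator passes to a
  divisor, which preserves coprimality.\<close>

lemma pointed_Z_retract_strongly_regular:
  assumes "pointed_Z_retract P"
  shows "strongly_regular P"
proof -
  obtain \<zeta> where z: "Z_map \<zeta>" "\<And>x. x \<in> unit_cube \<Longrightarrow> \<zeta> (\<zeta> x) = \<zeta> x" "P = \<zeta> ` unit_cube"
    using assms unfolding pointed_Z_retract_def pointed_Z_retraction_def by blast
  have zc: "\<zeta> x \<in> unit_cube" if "x \<in> unit_cube" for x using z(1) that unfolding Z_map_def by blast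
  have cont: "continuous_on unit_cube \<zeta>" using z(1) by (simp add: Z_map_def)
  have fix_P: "P = {x \<in> unit_cube. \<zeta> x = x}"
    unfolding z(3) using z(2) zc by (auto simp: image_iff) metis
  show ?thesis
    unfolding strongly_regular_def
  proof (intro conjI ballI allI impI)
    show "rational_polyhedron P" unfolding fix_P by (rule Z_map_fixed_points_rational_polyhedron[OF z(1)])
    fix v \<delta> assume v: "v \<in> P" "rational_vec v" and "\<delta> > (0::real)"
    have vc: "v \<in> unit_cube" "\<zeta> v = v" using v(1) fix_P by auto
    obtain \<epsilon> where \<epsilon>: "\<epsilon> > 0" "\<And>x. x \<in> unit_cube \<Longrightarrow> dist x v < \<epsilon> \<Longrightarrow> dist (\<zeta> x) (\<zeta> v) < \<delta>"
      using cont vc(1) \<open>\<delta> > 0\<close> unfolding continuous_on_iff by metis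
    obtain w where w: "w \<in> unit_cube" "rational_vec w" "dist v w < \<epsilon>" "coprime (den v) (den w)"
      using coprime_den_approx[OF vc(1) den_rational_vec(1)[OF v(2)] \<epsilon>(1)] by blast
    show "\<exists>w\<in>P. rational_vec w \<and> dist v w < \<delta> \<and> gcd (den v) (den w) = 1"
    proof (intro bexI[of _ "\<zeta> w"] conjI)
      show "\<zeta> w \<in> P" using z(3) w(1) by blast
      show "rational_vec (\<zeta> w)" by (rule Z_map_den(1)[OF z(1) w(1,2)])
      show "dist v (\<zeta> w) < \<delta>" using \<epsilon>(2)[OF w(1)] w(3) vc(2) by (simp add: dist_commute)
      have "coprime (den v) (den (\<zeta> w))"
        using w(4) Z_map_den(2)[OF z(1) w(1,2)] coprime_divisors dvd_refl by blast
      then show "gcd (den v) (den (\<zeta> w)) = 1" by (simp add: coprime_iff_gcd_eq_1)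
    qed
  qed
qed

theorem theorem5p4:
  fixes P :: "(real ^ 'n) set"
  shows "(pointed_Z_retract P \<longrightarrow> contractible P \<and> strongly_regular P) \<and>
    (rational_polyhedron P \<and> pointed P \<and> polyhedron_dim P = 1 \<and>
      contractible P \<and> strongly_regular P \<longrightarrow> pointed_Z_retract P)"
proof (intro conjI impI)
  show "contractible P" "strongly_regular P" if "pointed_Z_retract P"
    using that by (rule pointed_Z_retract_contractible, rule pointed_Z_retract_strongly_regular)
  show "pointed_Z_retract P"
    if "rational_polyhedron P \<and> pointed P \<and> polyhedron_dim P = 1 \<and> contractible P \<and> strongly_regular P"
    using that by (intro one_dim_retract) simp_all
qed

end
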